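(* Let $p$ be prime and $\mathcal A=\mathbb Z/p$. For $\lambda^D$-almost every $(\alpha_1,\dots,\alpha_D)\in\mathbf T^D$ (with $\varsigma$ the corresponding $\mathbb Z^D$-action on $\mathbf T$), there is a sequence $\{m_j\}_{j=1}^\infty\subset\mathbb N$ such that, if $n_j:=p^{m_j}$ for all $j$, then for any linear cellular automaton $\Phi:\mathcal A^{\mathbb L}\to\mathcal A^{\mathbb L}$: (a) If $\mathrm{trace}[\Phi]\equiv0\pmod p$, then $(\mathcal M,d_\triangle,\Phi_\varsigma)$ and $(\mathcal{QS}_\varsigma,d_B,\Phi)$ are niltropic along $\{n_k\}_{k=1}^\infty$. (b) If $\mathrm{trace}[\Phi]\not\equiv0\pmod p$, then $(\mathcal M,d_\triangle,\Phi_\varsigma)$ and $(\mathcal{QS}_\varsigma,d_B,\Phi)$ are rigid along $\{(p-1)\cdot n_k\}_{k=1}^\infty$.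
   Context: $D,K\ge1$, $\mathbb L=\mathbb Z^D$, $\mathbf T=(\mathbb R/\mathbb Z)^K$, $\lambda$ Lebesgue (Haar) probability measure on $\mathbf T$, $\lambda^D$ the product measure on $\mathbf T^D$. For $(\alpha_1,\dots,\alpha_D)\in\mathbf T^D$ put $\tau(\ell)=\ell_1\alpha_1+\cdots+\ell_D\alpha_D$ and $\varsigma^\ell(t)=t+\tau(\ell)$; only $(\alpha_d)$ for which $\tau$ is injective with dense image are considered (a full-measure set). A linear cellular automaton is $\Phi(\mathbf a)_\ell=\sum_{b\in B}\varphi_b\,a_{\ell+b}\pmod p$ with $B\subset\mathbb L$ finite and constants $\varphi_b\in\{1,\dots,p-1\}$; $\mathrm{trace}[\Phi]=\sum_{b\in B}\varphi_b\bmod p$; its local map is $\phi(\mathbf c)=\sum_b\varphi_bc_b$. $\mathcal M$ is the set of $\mathcal A$-labelled measurable partitions of $\mathbf T$: families $\mathcal P=\{P_a\}_{a\in\mathcal A}$ of disjoint measurable sets such that $P_*:=\bigsqcup_aP_a$ has $\lambda(P_* )=1$, with metric $d_\triangle(\mathcal P,\mathcal Q)=\sum_a\lambda(P_a\triangle Q_a)$ (partitions at distance $0$ are identified). $\Phi_\varsigma(\mathcal P)=\{Q_a\}_a$, $Q_a=\bigcup_{\mathbf c\in\mathcal A^B,\ \phi(\mathbf c)=a}\bigcap_{b\in B}\varsigma^{-b}(P_{c_b})$. An open partition is one with all $P_a$ open and $P_*$ dense; for such $\mathcal P$ let $\widetilde{\mathbf T}(\mathcal P)=\bigcap_\ell\varsigma^\ell(P_*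 )$ and, for $t\in\widetilde{\mathbf T}(\mathcal P)$, let $\mathcal P_\varsigma(t)\in\mathcal A^{\mathbb L}$ have $\ell$-th entry the unique $a$ with $\varsigma^\ell(t)\in P_a$. $\mathcal{QS}_\varsigma=\{\mathcal P_\varsigma(t):\mathcal P\text{ open partition},\ t\in\widetilde{\mathbf T}(\mathcal P)\}$. $d_B(\mathbf p,\mathbf q)=\limsup_{N\to\infty}\frac{\#\{\ell\in[-N,N)^D\cap\mathbb Z^D:\ p_\ell\ne q_\ell\}}{(2N)^D}$. Let $\mathbf o\in\mathcal A^{\mathbb L}$ be the constant zero configuration and $\mathcal Z\in\mathcal M$ the partition with $Z_0=\mathbf T$ and $Z_a=\emptyset$ for $a\ne0$. For $\{n_k\}\subset\mathbb N$: $(\mathcal{QS}_\varsigma,d_B,\Phi)$ is rigid (resp. niltropic) along $\{n_k\}$ if for all $\mathbf q\in\mathcal{QS}_\varsigma$, $d_B(\Phi^{n_k}(\mathbf q),\mathbf q)\to0$ (resp. $d_B(\Phi^{n_k}(\mathbf q),\mathbf o)\to0$) as $k\to\infty$; $(\mathcal M,d_\triangle,\Phi_\varsigma)$ is rigid (resp. niltropic) along $\{n_k\}$ if for all $\mathcal Q\in\mathcal M$, $d_\triangle(\Phi_\varsigma^{n_k}(\mathcal Q),\mathcal Q)\to0$ (resp. $d_\triangle(\Phi_\varsigma^{n_k}(\mathcal Q),\mathcal Z)\to0$). *)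

theory Defs
  imports "HOL-Probability.Probability"
begin

section \<open>The torus\<close>

quotient_type circle = real / "\<lambda>x y :: real. x - y \<in> \<int>"
proof (intro equivpI reflpI sympI transpI)
  fix x y z :: real
  show "x - x \<in> \<int>" by simp
  show "y - x \<in> \<int>" if "x - y \<in> \<int>"
    using Ints_minus[OF that] by simp
  show "x - z \<in> \<int>" if "x - y \<in> \<int>" "y - z \<in> \<int>"
    using Ints_add[OF that] by simp
qed

instantiation circle :: ab_group_add
begin

lift_definition zero_circle :: circle is 0 .

lift_definition plus_circle :: "circle \<Rightarrow> circle \<Rightarrow> circle" is "(+)"
  by (metis Ints_add add_diff_add)

lift_definition uminus_circle :: "circle \<Rightarrow> circle" is uminus
  by (metis Ints_minus minus_diff_minus)

definition minus_circle :: "circle \<Rightarrow> circle \<Rightarrow> circle" where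
  "minus_circle x y = x + - y"

instance
proof
  fix a b c :: circle
  show "a + b + c = a + (b + c)" by transfer (simp add: add.assoc)
  show "a + b = b + a" by transfer (simp add: add.commute)
  show "0 + a = a" by transfer simp
  show "- a + a = 0" by transfer simp
  show "a - b = a + - b" by (rule minus_circle_def)
qed

end

text \<open>The quotient topology.\<close>

instantiation circle :: topological_space
begin

definition open_circle :: "circle set \<Rightarrow> bool" where
  "open_circle U \<longleftrightarrow> open (abs_circle -` U)"

instance
  by standard (auto simp: open_circle_def vimage_Union open_Int intro!: open_UN)

end

lift_definition int_mult :: "int \<Rightarrow> circle \<Rightarrow> circle" is "\<lambda>n x. of_int n * x"
  by (metis Ints_mult Ints_of_int right_diff_distrib)

text \<open>
  The torus \<open>(\<real>/\<int>)\<^sup>K\<close> is the type \<^typ>\<open>circle^'k\<close>, with the componentwise group structure and the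
  product topology, and the lattice \<open>\<int>\<^sup>D\<close> is \<^typ>\<open>int^'d\<close>.
\<close>

definition to_torus :: "real^'k \<Rightarrow> circle^'k" where
  "to_torus x = (\<chi> i. abs_circle (x $ i))"

text \<open>
  Haar probability measure on the Borel sets, as the image of Lebesgue measure on the unit cube,
  and its completion, whose measurable sets are the Lebesgue measurable subsets of the torus.
\<close>

definition haar :: "(circle^'k) measure" where
  "haar = distr (uniform_measure lborel (cbox 0 1)) borel to_torus"

definition leb :: "(circle^'k) measure" where
  "leb = completion haar"

lemma continuous_abs_circle: "continuous_on UNIV abs_circle"
  by (simp add: continuous_on_open_vimage open_circle_def)

lemma continuous_to_torus: "continuous_on UNIV to_torus"
  unfolding to_torus_def
  by (intro continuous_intros continuous_on_compose2[OF continuous_abs_circle]) auto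

lemma prob_space_haar: "prob_space (haar :: (circle^'k) measure)"
proof -
  have m: "to_torus \<in> borel_measurable (uniform_measure lborel (cbox 0 (1 :: real^'k)))"
    using borel_measurable_continuous_onI[OF continuous_to_torus]
    by (simp add: measurable_def)
  have one: "1 \<bullet> b = 1" if "b \<in> Basis" for b :: "real^'k"
    using that by (auto simp: Basis_vec_def inner_axis)
  have "emeasure lborel (cbox 0 (1 :: real^'k)) = 1"
    by (subst emeasure_lborel_cbox) (simp_all add: one)
  then have "prob_space (uniform_measure lborel (cbox 0 (1 :: real^'k)))"
    by (intro prob_space_uniform_measure) auto
  then show ?thesis
    unfolding haar_def using m by (rule prob_space.prob_space_distr)
qed

lemma prob_space_leb: "prob_space (leb :: (circle^'k) measure)"
  unfolding leb_def using prob_space_haar by (rule prob_space.prob_space_completion)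

section \<open>The translation action\<close>

definition tau :: "('d::finite \<Rightarrow> circle^'k) \<Rightarrow> int^'d \<Rightarrow> circle^'k" where
  "tau \<alpha> l = (\<Sum>d\<in>UNIV. \<chi> i. int_mult (l $ d) (\<alpha> d $ i))"

definition shift :: "('d::finite \<Rightarrow> circle^'k) \<Rightarrow> int^'d \<Rightarrow> circle^'k \<Rightarrow> circle^'k" where
  "shift \<alpha> l t = t + tau \<alpha> l"

definition admissible :: "('d::finite \<Rightarrow> circle^'k) \<Rightarrow> bool" where
  "admissible \<alpha> \<longleftrightarrow> inj (tau \<alpha>) \<and> closure (range (tau \<alpha>)) = UNIV"

section \<open>Linear cellular automata\<close>

text \<open>
  The alphabet \<open>\<int>/p\<close> is represented by the residues \<open>{..<p}\<close>, with arithmetic modulo \<open>p\<close>.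
\<close>

definition linear_ca :: "nat \<Rightarrow> (int^'d) set \<Rightarrow> (int^'d \<Rightarrow> nat) \<Rightarrow> bool" where
  "linear_ca p B \<phi> \<longleftrightarrow> finite B \<and> (\<forall>b\<in>B. \<phi> b \<in> {1..p - 1})"

definition local_map :: "nat \<Rightarrow> (int^'d) set \<Rightarrow> (int^'d \<Rightarrow> nat) \<Rightarrow> (int^'d \<Rightarrow> nat) \<Rightarrow> nat" where
  "local_map p B \<phi> c = (\<Sum>b\<in>B. \<phi> b * c b) mod p"

definition ca_map ::
  "nat \<Rightarrow> (int^'d) set \<Rightarrow> (int^'d \<Rightarrow> nat) \<Rightarrow> (int^'d \<Rightarrow> nat) \<Rightarrow> int^'d \<Rightarrow> nat" where
  "ca_map p B \<phi> a l = local_map p B \<phi> (\<lambda>b. a (l + b))"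

definition ca_trace :: "nat \<Rightarrow> (int^'d) set \<Rightarrow> (int^'d \<Rightarrow> nat) \<Rightarrow> nat" where
  "ca_trace p B \<phi> = (\<Sum>b\<in>B. \<phi> b) mod p"

section \<open>Labelled partitions\<close>

text \<open>
  A family labelled by \<open>{..<p}\<close> is a function on \<^typ>\<open>nat\<close> whose values at labels \<open>\<ge> p\<close> are ignored.
  The identification of partitions at distance zero is not performed: \<open>d_tri\<close> is
  used as a pseudometric.
\<close>

definition part_union :: "nat \<Rightarrow> (nat \<Rightarrow> (circle^'k) set) \<Rightarrow> (circle^'k) set" where
  "part_union p P = (\<Union>a<p. P a)"

definition partitions :: "nat \<Rightarrow> (nat \<Rightarrow> (circle^'k) set) set" where
  "partitions p = {P. (\<forall>a<p. P a \<in> sets leb) \<and> disjoint_family_on P {..<p}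
                     \<and> measure leb (part_union p P) = 1}"

definition d_tri :: "nat \<Rightarrow> (nat \<Rightarrow> (circle^'k) set) \<Rightarrow> (nat \<Rightarrow> (circle^'k) set) \<Rightarrow> real" where
  "d_tri p P Q = (\<Sum>a<p. measure leb (sym_diff (P a) (Q a)))"

definition ca_part ::
  "nat \<Rightarrow> ('d::finite \<Rightarrow> circle^'k) \<Rightarrow> (int^'d) set \<Rightarrow> (int^'d \<Rightarrow> nat)
    \<Rightarrow> (nat \<Rightarrow> (circle^'k) set) \<Rightarrow> nat \<Rightarrow> (circle^'k) set" where
  "ca_part p \<alpha> B \<phi> P a =
     (\<Union>c\<in>{c \<in> B \<rightarrow>\<^sub>E {..<p}. local_map p B \<phi> c = a}. \<Inter>b\<in>B. shift \<alpha> (- b) ` P (c b))"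

definition zero_part :: "nat \<Rightarrow> (circle^'k) set" where
  "zero_part a = (if a = 0 then UNIV else {})"

section \<open>Quasisturmian configurations\<close>

definition open_partition :: "nat \<Rightarrow> (nat \<Rightarrow> (circle^'k) set) \<Rightarrow> bool" where
  "open_partition p P \<longleftrightarrow>
     P \<in> partitions p \<and> (\<forall>a<p. open (P a)) \<and> closure (part_union p P) = UNIV"

definition good_points ::
  "nat \<Rightarrow> ('d::finite \<Rightarrow> circle^'k) \<Rightarrow> (nat \<Rightarrow> (circle^'k) set) \<Rightarrow> (circle^'k) set" where
  "good_points p \<alpha> P = (\<Inter>l. shift \<alpha> l ` part_union p P)"

definition config_of ::
  "nat \<Rightarrow> ('d::finite \<Rightarrow> circle^'k) \<Rightarrow> (nat \<Rightarrow> (circle^'k) set) \<Rightarrow> circle^'k \<Rightarrow> int^'d \<Rightarrow> nat" where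
  "config_of p \<alpha> P t l = (THE a. a < p \<and> shift \<alpha> l t \<in> P a)"

definition QS :: "nat \<Rightarrow> ('d::finite \<Rightarrow> circle^'k) \<Rightarrow> (int^'d \<Rightarrow> nat) set" where
  "QS p \<alpha> = {config_of p \<alpha> P t | P t. open_partition p P \<and> t \<in> good_points p \<alpha> P}"

definition d_B :: "(int^'d \<Rightarrow> nat) \<Rightarrow> (int^'d \<Rightarrow> nat) \<Rightarrow> ereal" where
  "d_B x y = limsup (\<lambda>N::nat. ereal (
     real (card {l :: int^'d. (\<forall>d. l $ d \<in> {- int N..<int N}) \<and> x l \<noteq> y l})
       / (2 * real N) ^ CARD('d)))"

section \<open>Rigidity and niltropy along a sequence\<close>

definition rigid_QS ::
  "nat \<Rightarrow> ('d::finite \<Rightarrow> circle^'k) \<Rightarrow> (int^'d) set \<Rightarrow> (int^'d \<Rightarrow> nat) \<Rightarrow> (nat \<Rightarrow> nat) \<Rightarrow> bool" where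
  "rigid_QS p \<alpha> B \<phi> n \<longleftrightarrow>
     (\<forall>q\<in>QS p \<alpha>. (\<lambda>k. d_B ((ca_map p B \<phi> ^^ n k) q) q) \<longlonglongrightarrow> 0)"

definition niltropic_QS ::
  "nat \<Rightarrow> ('d::finite \<Rightarrow> circle^'k) \<Rightarrow> (int^'d) set \<Rightarrow> (int^'d \<Rightarrow> nat) \<Rightarrow> (nat \<Rightarrow> nat) \<Rightarrow> bool" where
  "niltropic_QS p \<alpha> B \<phi> n \<longleftrightarrow>
     (\<forall>q\<in>QS p \<alpha>. (\<lambda>k. d_B ((ca_map p B \<phi> ^^ n k) q) (\<lambda>_. 0)) \<longlonglongrightarrow> 0)"

definition rigid_M ::
  "nat \<Rightarrow> ('d::finite \<Rightarrow> circle^'k) \<Rightarrow> (int^'d) set \<Rightarrow> (int^'d \<Rightarrow> nat) \<Rightarrow> (nat \<Rightarrow> nat) \<Rightarrow> bool" where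
  "rigid_M p \<alpha> B \<phi> n \<longleftrightarrow>
     (\<forall>Q\<in>partitions p. (\<lambda>k. d_tri p ((ca_part p \<alpha> B \<phi> ^^ n k) Q) Q) \<longlonglongrightarrow> 0)"

definition niltropic_M ::
  "nat \<Rightarrow> ('d::finite \<Rightarrow> circle^'k) \<Rightarrow> (int^'d) set \<Rightarrow> (int^'d \<Rightarrow> nat) \<Rightarrow> (nat \<Rightarrow> nat) \<Rightarrow> bool" where
  "niltropic_M p \<alpha> B \<phi> n \<longleftrightarrow>
     (\<forall>Q\<in>partitions p. (\<lambda>k. d_tri p ((ca_part p \<alpha> B \<phi> ^^ n k) Q) zero_part) \<longlonglongrightarrow> 0)"

end

theory Submission
  imports Defs "HOL-Library.Poly_Mapping"
begin

text \<open>
  Modulo \<open>p\<close>, a linear cellular automaton is multiplication by an element \<open>F\<close> of the group ring of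
  \<open>\<int>\<^sup>D\<close>. By the Frobenius identity, \<open>F\<close> raised to the power \<open>p\<^sup>m\<close> has the same coefficients as
  \<open>F\<close>, with its support dilated by \<open>p\<^sup>m\<close>. Hence, if a configuration takes the same value at \<open>l\<close>
  and at all the dilated neighbours \<open>l + p\<^sup>m b\<close>, then the iterate of order \<open>p\<^sup>m\<close> multiplies its
  entry at \<open>l\<close> by the trace. If the trace vanishes, the entry becomes \<open>0\<close>. Otherwise the same
  argument applied to \<open>F\<close> raised to the power \<open>p - 1\<close>, whose trace is \<open>1\<close> by Fermat's little
  theorem, shows that the entry is restored (\<open>ca_map_niltropic\<close> and \<open>ca_map_rigid\<close>).

  It remains to choose \<open>m\<close> such that most entries agree with their dilated neighbours. The entry at
  \<open>l\<close> of the configuration of a point \<open>t\<close> is the label of \<open>t + \<tau>(l)\<close>, and its dilated neighbour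
  is the label of a point that is \<open>\<tau>(p\<^sup>m b) = p\<^sup>m \<tau>(b)\<close> further away. So it suffices that
  \<open>p\<^sup>m \<alpha>\<^sub>d\<close> tends to \<open>0\<close> along the chosen sequence, for all \<open>d\<close> at once. For almost every
  \<open>\<alpha>\<close> the points \<open>p\<^sup>m \<alpha>\<close> are even dense in the torus of dimension \<open>K D\<close> (\<open>AE_dense_orbit\<close>):
  divide the cube into \<open>q\<^bsup>K D\<^esup>\<close> cells, where \<open>q\<close> is a power of \<open>p\<close>; the set of points that never
  visit a given cell is covered by copies of itself, scaled by \<open>1 / q\<close>, in the other cells,
  and is therefore null. The same density yields that \<open>\<tau>\<close> is injective with dense image.

  For a measurable partition, the points whose label changes under a small translation have
  small measure, because translation is continuous in measure
  (\<open>measure_leb_translation_continuous\<close>); this settles the metric of partitions.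
  For an open partition and a single orbit, one has to bound the density of the times at which the
  orbit visits the points close to the boundary. If \<open>U\<close> contains a neighbourhood of \<open>A\<close> of
  positive width, then the upper density of the visits of any orbit to \<open>A\<close> is at most the measure
  of \<open>U\<close> (\<open>limsup_visits_le\<close>): average over a finite family of lattice vectors whose images under
  \<open>\<tau>\<close> approximate a fine grid of the torus. The points within \<open>e\<close> of the boundary shrink to
  a null set as \<open>e\<close> tends to \<open>0\<close>, so this settles the Besicovitch metric.
\<close>

section \<open>The distance to zero on the torus\<close>

text \<open>
  The length of a shortest arc from \<open>0\<close> to the given point of the circle.
\<close>

lift_definition cnorm :: "circle \<Rightarrow> real" is "\<lambda>x. \<bar>x - of_int (round x)\<bar>"
proof -
  fix x y :: real
  assume "x - y \<in> \<int>"
  then obtain n :: int where n: "x = y + of_int n"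
    by (metis Ints_cases diff_eq_eq add.commute)
  show "\<bar>x - of_int (round x)\<bar> = \<bar>y - of_int (round y)\<bar>"
    using floor_add_int[of "y + 1 / 2" n] by (simp add: n round_def algebra_simps)
qed

lemma cnorm_abs_circle_le: "cnorm (abs_circle x) \<le> \<bar>x - of_int z\<bar>"
  by transfer (rule round_diff_minimal)

lemma cnorm_abs_circle_le_abs: "cnorm (abs_circle x) \<le> \<bar>x\<bar>"
  using cnorm_abs_circle_le[of x 0] by simp

lemma cnorm_lift: obtains x where "abs_circle x = c" "\<bar>x\<bar> = cnorm c"
proof -
  obtain y where y: "abs_circle y = c"
    by (metis Quotient_abs_rep[OF Quotient_circle])
  have "abs_circle (y - of_int (round y)) = c"
    unfolding y[symmetric] circle.abs_eq_iff by simp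
  moreover have "\<bar>y - of_int (round y)\<bar> = cnorm c"
    unfolding y[symmetric] by (simp add: cnorm.abs_eq)
  ultimately show ?thesis using that by blast
qed

lemma cnorm_nonneg [simp]: "0 \<le> cnorm c"
  by transfer simp

lemma cnorm_zero [simp]: "cnorm 0 = 0"
  by transfer simp

lemma abs_circle_add: "abs_circle (x + y) = abs_circle x + abs_circle y"
  by (simp add: plus_circle.abs_eq)

lemma abs_circle_minus: "abs_circle (- x) = - abs_circle x"
  by (simp add: uminus_circle.abs_eq)

lemma abs_circle_diff: "abs_circle (x - y) = abs_circle x - abs_circle y"
  using abs_circle_add[of x "-y"] by (simp add: abs_circle_minus)

lemma int_mult_abs_circle: "int_mult n (abs_circle x) = abs_circle (of_int n * x)"
  by (simp add: int_mult.abs_eq)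

lemma cnorm_triangle: "cnorm (a + b) \<le> cnorm a + cnorm b"
proof -
  obtain x y where "abs_circle x = a" "\<bar>x\<bar> = cnorm a" "abs_circle y = b" "\<bar>y\<bar> = cnorm b"
    by (metis cnorm_lift)
  then show ?thesis
    using cnorm_abs_circle_le_abs[of "x + y"] by (auto simp: abs_circle_add)
qed

lemma cnorm_uminus [simp]: "cnorm (- a) = cnorm a"
proof -
  have "cnorm (- c) \<le> cnorm c" for c
    by (metis cnorm_lift cnorm_abs_circle_le_abs abs_circle_minus abs_minus_cancel)
  from this[of a] this[of "- a"] show ?thesis by simp
qed

lemma cnorm_int_mult_le: "cnorm (int_mult n a) \<le> \<bar>of_int n\<bar> * cnorm a"
  by (metis cnorm_lift cnorm_abs_circle_le_abs int_mult_abs_circle abs_mult)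

lemma int_mult_add_right: "int_mult n (a + b) = int_mult n a + int_mult n b"
  by transfer (simp add: algebra_simps)

lemma int_mult_diff_right: "int_mult n (a - b) = int_mult n a - int_mult n b"
  unfolding minus_circle_def by transfer (simp add: algebra_simps)

lemma int_mult_add_left: "int_mult (m + n) a = int_mult m a + int_mult n a"
  by transfer (simp add: algebra_simps)

lemma int_mult_mult: "int_mult (m * n) a = int_mult m (int_mult n a)"
  by transfer (simp add: algebra_simps)

lemma int_mult_0 [simp]: "int_mult 0 a = 0" by transfer simp
lemma int_mult_zero_right [simp]: "int_mult n 0 = 0" by transfer simp

text \<open>
  The maximum over the coordinates is taken so that balls are products of arcs, images of cubes.
\<close>

definition tnorm :: "circle^'k \<Rightarrow> real" where
  "tnorm s = Max (range (\<lambda>i. cnorm (s $ i)))"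

lemma tnorm_less_iff: "tnorm s < e \<longleftrightarrow> (\<forall>i. cnorm (s $ i) < e)"
  by (auto simp: tnorm_def)

lemma tnorm_le_iff: "tnorm s \<le> e \<longleftrightarrow> (\<forall>i. cnorm (s $ i) \<le> e)"
  by (auto simp: tnorm_def)

lemma cnorm_nth_le: "cnorm (s $ i) \<le> tnorm s"
  by (auto simp: tnorm_def intro!: Max_ge)

lemma tnorm_nonneg [simp]: "0 \<le> tnorm s"
  using order_trans[OF cnorm_nonneg cnorm_nth_le] .

lemma tnorm_zero [simp]: "tnorm 0 = 0"
  using tnorm_le_iff[of 0 0] tnorm_nonneg[of 0] by (auto intro: antisym)

lemma tnorm_uminus [simp]: "tnorm (- s) = tnorm s"
  by (simp add: tnorm_def)

lemma tnorm_triangle: "tnorm (s + t) \<le> tnorm s + tnorm t"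
  unfolding tnorm_le_iff[of "s + t"]
  by (metis vector_add_component cnorm_triangle cnorm_nth_le add_mono order_trans)

lemma tnorm_minus_commute: "tnorm (s - t) = tnorm (t - s)"
  using tnorm_uminus[of "s - t"] by simp

lemma tnorm_triangle_less:
  "tnorm (s - t) < d \<Longrightarrow> tnorm (t - u) < e \<Longrightarrow> tnorm (s - u) < d + e"
  using tnorm_triangle[of "s - t" "t - u"] by simp

lemma tnorm_sum_le: "tnorm (sum f A) \<le> (\<Sum>x\<in>A. tnorm (f x))"
  by (induction A rule: infinite_finite_induct)
     (auto intro: order_trans[OF tnorm_triangle])

lemma to_torus_add: "to_torus (x + y) = to_torus x + to_torus y"
  by (simp add: to_torus_def vec_eq_iff abs_circle_add)

lemma to_torus_diff: "to_torus (x - y) = to_torus x - to_torus y"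
  by (simp add: to_torus_def vec_eq_iff abs_circle_diff)

text \<open>
  Short representatives exist for all coordinates simultaneously; they carry small vectors of the
  torus to small vectors of the Euclidean space.
\<close>

lemma to_torus_lift:
  obtains x where "to_torus x = s" "\<And>i. \<bar>x $ i\<bar> = cnorm (s $ i)"
proof -
  have "\<forall>i. \<exists>x. abs_circle x = s $ i \<and> \<bar>x\<bar> = cnorm (s $ i)"
    by (metis cnorm_lift)
  then obtain f where "\<forall>i. abs_circle (f i) = s $ i \<and> \<bar>f i\<bar> = cnorm (s $ i)" by metis
  then show ?thesis
    by (intro that[of "\<chi> i. f i"]) (auto simp: to_torus_def vec_eq_iff)
qed

lemma to_torus_surj: obtains x where "to_torus x = s"
  using to_torus_lift by blast

lemma tnorm_to_torus_less: "(\<And>i. \<bar>x $ i\<bar> < e) \<Longrightarrow> tnorm (to_torus x) < e"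
  unfolding tnorm_less_iff to_torus_def
  by (auto intro: order_le_less_trans[OF cnorm_abs_circle_le_abs])

lemma to_torus_of_int: "(\<And>i. z $ i \<in> \<int>) \<Longrightarrow> to_torus (x + z) = to_torus x"
  by (auto simp: to_torus_def vec_eq_iff circle.abs_eq_iff)

text \<open>
  Multiplication by an integer in the group; it expresses both \<open>\<tau>\<close> and the map that multiplies
  a point by \<open>p\<close>.
\<close>

definition tmult :: "int \<Rightarrow> circle^'k \<Rightarrow> circle^'k" where
  "tmult n s = (\<chi> i. int_mult n (s $ i))"

lemma tmult_to_torus: "tmult n (to_torus x) = to_torus (of_int n *\<^sub>R x)"
  by (simp add: tmult_def to_torus_def vec_eq_iff int_mult_abs_circle)

lemma tmult_nth [simp]: "tmult n s $ i = int_mult n (s $ i)"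
  by (simp add: tmult_def)

lemma tmult_diff_right: "tmult n (s - t) = tmult n s - tmult n t"
  by (simp add: vec_eq_iff int_mult_diff_right)

lemma tmult_mult: "tmult (m * n) s = tmult m (tmult n s)"
  by (simp add: vec_eq_iff int_mult_mult)

lemma tnorm_tmult_le: "tnorm (tmult n s) \<le> \<bar>of_int n\<bar> * tnorm s"
  unfolding tnorm_le_iff tmult_nth
  by (intro allI order_trans[OF cnorm_int_mult_le] mult_left_mono cnorm_nth_le) auto

lemma tau_eq: "tau \<alpha> l = (\<Sum>d\<in>UNIV. tmult (l $ d) (\<alpha> d))"
  by (simp add: tau_def tmult_def)

lemma tmult_add_left: "tmult (m + n) s = tmult m s + tmult n s"
  by (simp add: vec_eq_iff int_mult_add_left)

lemma tmult_0 [simp]: "tmult 0 s = 0" by (simp add: vec_eq_iff)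

lemma tmult_zero_right [simp]: "tmult n 0 = 0" by (simp add: vec_eq_iff)

lemma tmult_add_right: "tmult n (s + t) = tmult n s + tmult n t"
  by (simp add: vec_eq_iff int_mult_add_right)

lemma tmult_sum: "tmult n (sum f A) = (\<Sum>x\<in>A. tmult n (f x))"
  by (induction A rule: infinite_finite_induct) (auto simp: tmult_add_right)

lemma tau_add: "tau \<alpha> (l + l') = tau \<alpha> l + tau \<alpha> l'"
  by (simp add: tau_eq tmult_add_left sum.distrib)

lemma tau_0 [simp]: "tau \<alpha> 0 = 0"
  by (simp add: tau_eq)

lemma tau_minus: "tau \<alpha> (- l) = - tau \<alpha> l"
  using tau_add[of \<alpha> l "- l"] by (simp add: eq_neg_iff_add_eq_0 add.commute)

lemma tau_diff: "tau \<alpha> (l - l') = tau \<alpha> l - tau \<alpha> l'"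
  using tau_add[of \<alpha> l "- l'"] by (simp add: tau_minus)

section \<open>Topology of the torus\<close>

lemma open_abs_circle_image:
  assumes "open U" shows "open (abs_circle ` U)"
proof -
  have "abs_circle -` (abs_circle ` U) = (\<Union>n::int. (+) (of_int n) ` U)"
  proof (intro set_eqI iffI)
    fix x assume "x \<in> abs_circle -` (abs_circle ` U)"
    then obtain y where y: "y \<in> U" "abs_circle x = abs_circle y" by auto
    then obtain n :: int where "x - y = of_int n"
      unfolding circle.abs_eq_iff by (auto elim: Ints_cases)
    then show "x \<in> (\<Union>n::int. (+) (of_int n) ` U)" using y
      by (auto intro!: exI[of _ n] image_eqI[of _ _ y])
  next
    fix x assume "x \<in> (\<Union>n::int. (+) (of_int n) ` U)"
    then obtain n :: int and y where "y \<in> U" "x = of_int n + y" by auto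
    then show "x \<in> abs_circle -` (abs_circle ` U)"
      by (auto intro!: image_eqI[of _ _ y] simp: circle.abs_eq_iff)
  qed
  then show ?thesis
    unfolding open_circle_def using assms by (auto intro!: open_translation)
qed

lemma cnorm_ball_eq: "{c. cnorm (c - abs_circle x) < e} = abs_circle ` {x - e<..<x + e}"
proof (intro set_eqI iffI)
  fix c assume "c \<in> {c. cnorm (c - abs_circle x) < e}"
  moreover obtain y where y: "abs_circle y = c - abs_circle x" "\<bar>y\<bar> = cnorm (c - abs_circle x)"
    by (metis cnorm_lift)
  ultimately have "\<bar>y\<bar> < e" "c = abs_circle (x + y)" by (auto simp: abs_circle_add)
  then show "c \<in> abs_circle ` {x - e<..<x + e}"
    by (intro image_eqI[of _ _ "x + y"]) auto
next
  fix c assume "c \<in> abs_circle ` {x - e<..<x + e}"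
  then obtain y where y: "c = abs_circle y" "\<bar>y - x\<bar> < e" by auto
  then show "c \<in> {c. cnorm (c - abs_circle x) < e}"
    using cnorm_abs_circle_le_abs[of "y - x"] by (auto simp: abs_circle_diff)
qed

lemma open_tnorm_ball: "open {s. tnorm (s - t) < e}"
proof -
  obtain x where x: "to_torus x = t" by (rule to_torus_surj)
  have "{s. tnorm (s - t) < e} = {s. \<forall>i. s $ i \<in> abs_circle ` {x $ i - e<..<x $ i + e}}"
    by (auto simp: tnorm_less_iff x[symmetric] to_torus_def simp flip: cnorm_ball_eq)
  also have "open \<dots>"
    by (intro open_vector_box allI open_abs_circle_image) auto
  finally show ?thesis .
qed

text \<open>
  The projection from the Euclidean space is continuous, so an open set contains the image of a
  ball, and short representatives fill a ball of the torus from there.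
\<close>

lemma open_torus_ball:
  fixes A :: "(circle^'k) set"
  assumes "open A" "s \<in> A"
  obtains e where "e > 0" "\<And>t. tnorm (t - s) < e \<Longrightarrow> t \<in> A"
proof -
  obtain x where x: "to_torus x = s" by (rule to_torus_surj)
  have "open (to_torus -` A)"
    using assms(1) continuous_to_torus by (rule open_vimage)
  moreover have "x \<in> to_torus -` A" using x assms by simp
  ultimately obtain e where e: "e > 0" "ball x e \<subseteq> to_torus -` A"
    by (meson open_contains_ball)
  define d where "d = e / real CARD('k)"
  have "d > 0" using e by (simp add: d_def)
  moreover have "t \<in> A" if "tnorm (t - s) < d" for t
  proof -
    obtain y where y: "to_torus y = t - s" "\<And>i. \<bar>y $ i\<bar> = cnorm ((t - s) $ i)"
      by (rule to_torus_lift) blast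
    have "norm y \<le> (\<Sum>i\<in>UNIV. \<bar>y $ i\<bar>)" by (rule norm_le_l1_cart)
    also have "\<dots> < (\<Sum>i\<in>(UNIV :: 'k set). d)"
      using that y by (intro sum_strict_mono) (auto simp: tnorm_less_iff)
    also have "\<dots> = e" by (simp add: d_def)
    finally have "x + y \<in> ball x e" by (simp add: dist_norm)
    then have "to_torus (x + y) \<in> A" using e by auto
    then show ?thesis using x y by (simp add: to_torus_add)
  qed
  ultimately show ?thesis using that by blast
qed

lemma open_torus_iff:
  fixes A :: "(circle^'k) set"
  shows "open A \<longleftrightarrow> (\<forall>s\<in>A. \<exists>e>0. \<forall>t. tnorm (t - s) < e \<longrightarrow> t \<in> A)"
proof
  assume "open A" then show "\<forall>s\<in>A. \<exists>e>0. \<forall>t. tnorm (t - s) < e \<longrightarrow> t \<in> A"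
    by (metis open_torus_ball)
next
  assume *: "\<forall>s\<in>A. \<exists>e>0. \<forall>t. tnorm (t - s) < e \<longrightarrow> t \<in> A"
  show "open A"
    unfolding open_subopen[of A]
  proof
    fix s assume "s \<in> A"
    then obtain e where e: "e > 0" "\<And>t. tnorm (t - s) < e \<Longrightarrow> t \<in> A" using * by blast
    then show "\<exists>T. open T \<and> s \<in> T \<and> T \<subseteq> A"
      by (intro exI[of _ "{t. tnorm (t - s) < e}"]) (auto intro: open_tnorm_ball)
  qed
qed

lemma continuous_torus_lipschitz:
  fixes f :: "circle^'k \<Rightarrow> circle^'k"
  assumes "c > 0" "\<And>s t. tnorm (f s - f t) \<le> c * tnorm (s - t)"
  shows "continuous_on UNIV f"
proof (subst continuous_on_open_vimage, simp, intro allI impI)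
  fix B :: "(circle^'k) set" assume B: "open B"
  show "open (f -` B \<inter> UNIV)"
    unfolding open_torus_iff
  proof
    fix s assume "s \<in> f -` B \<inter> UNIV"
    then obtain e where e: "e > 0" "\<And>t. tnorm (t - f s) < e \<Longrightarrow> t \<in> B"
      using B unfolding open_torus_iff by fast
    have "t \<in> f -` B \<inter> UNIV" if "tnorm (t - s) < e / c" for t
    proof -
      have "c * tnorm (t - s) < e" using that \<open>c > 0\<close> by (simp add: field_simps)
      then show ?thesis using assms(2)[of t s] e(2) by auto
    qed
    then show "\<exists>d>0. \<forall>t. tnorm (t - s) < d \<longrightarrow> t \<in> f -` B \<inter> UNIV"
      using e(1) \<open>c > 0\<close> by (intro exI[of _ "e / c"]) auto
  qed
qed

lemma continuous_torus_add: "continuous_on UNIV (\<lambda>s :: circle^'k. s + h)"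
  by (rule continuous_torus_lipschitz[of 1]) simp_all

lemma continuous_tmult: "continuous_on UNIV (tmult n :: circle^'k \<Rightarrow> circle^'k)"
proof (rule continuous_torus_lipschitz[of "\<bar>of_int n\<bar> + 1"])
  fix s t :: "circle^'k"
  have "tnorm (tmult n s - tmult n t) \<le> \<bar>of_int n\<bar> * tnorm (s - t)"
    using tnorm_tmult_le[of n "s - t"] by (simp add: tmult_diff_right)
  then show "tnorm (tmult n s - tmult n t) \<le> (\<bar>of_int n\<bar> + 1) * tnorm (s - t)"
    using tnorm_nonneg[of "s - t"] by (simp add: distrib_right add_increasing2)
qed auto

section \<open>Translation invariance of Haar measure\<close>

definition int_vec :: "int^'k \<Rightarrow> real^'k" where
  "int_vec z = (\<chi> i. of_int (z $ i))"

lemma int_vec_nth [simp]: "int_vec z $ i = of_int (z $ i)"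
  by (simp add: int_vec_def)

lemma to_torus_int_vec [simp]: "to_torus (x + int_vec z) = to_torus x"
  by (rule to_torus_of_int) auto

definition unit_cube_at :: "real^'k \<Rightarrow> (real^'k) set" where
  "unit_cube_at y = {x. \<forall>i. y $ i \<le> x $ i \<and> x $ i < y $ i + 1}"

lemma unit_cube_at_borel [measurable]: "unit_cube_at y \<in> sets borel"
proof -
  have "unit_cube_at y = (\<Inter>i\<in>UNIV. {x. y $ i \<le> x $ i} \<inter> {x. x $ i < y $ i + 1})"
    by (auto simp: unit_cube_at_def)
  also have "\<dots> \<in> sets borel"
    by (intro sets.finite_INT sets.Int)
       (auto intro!: borel_closed borel_open closed_Collect_le open_Collect_less continuous_intros)
  finally show ?thesis .
qed

lemma emeasure_lborel_translate:
  fixes X :: "('a::euclidean_space) set"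
  assumes "X \<in> sets borel"
  shows "emeasure lborel ((+) a -` X) = emeasure lborel X"
proof -
  have "emeasure lborel X = emeasure (distr lborel borel ((+) a)) X"
    by (simp add: lborel_distr_plus)
  also have "\<dots> = emeasure lborel ((+) a -` X)"
    using assms by (subst emeasure_distr) auto
  finally show ?thesis ..
qed

lemma unit_cube_at_add: "(x + a \<in> unit_cube_at (y + a)) = (x \<in> unit_cube_at y)"
  by (auto simp: unit_cube_at_def)

lemma unit_cube_at_plus: "(a + x \<in> unit_cube_at y) = (x \<in> unit_cube_at (y - a))"
  using unit_cube_at_add[of x a "y - a"] by (simp add: add.commute)

lemma unit_cubes_tile: "\<exists>!z. x \<in> unit_cube_at (y + int_vec z)"
proof
  show "x \<in> unit_cube_at (y + int_vec (\<chi> i. \<lfloor>x $ i - y $ i\<rfloor>))"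
    unfolding unit_cube_at_def
  proof (intro CollectI allI)
    fix i
    show "(y + int_vec (\<chi> i. \<lfloor>x $ i - y $ i\<rfloor>)) $ i \<le> x $ i
      \<and> x $ i < (y + int_vec (\<chi> i. \<lfloor>x $ i - y $ i\<rfloor>)) $ i + 1"
      using floor_correct[of "x $ i - y $ i"] by (simp, linarith)
  qed
next
  fix z assume z: "x \<in> unit_cube_at (y + int_vec z)"
  have "z $ i = \<lfloor>x $ i - y $ i\<rfloor>" for i
    using z by (intro floor_unique[symmetric]) (auto simp: unit_cube_at_def algebra_simps)
  then show "z = (\<chi> i. \<lfloor>x $ i - y $ i\<rfloor>)" by (simp add: vec_eq_iff)
qed

lemma unit_cubes_tile_minus: "\<exists>!z. x \<in> unit_cube_at (y - int_vec z)"
proof -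
  have *: "y - int_vec z = y + int_vec (- z)" for z by (simp add: vec_eq_iff)
  show ?thesis unfolding * using unit_cubes_tile[of x y] by (metis minus_minus)
qed

text \<open>
  Cut both cubes along the lattice of integer translates of the other one. The pieces correspond
  to each other under integer translations, which preserve \<open>S\<close> and Lebesgue measure.
\<close>

lemma emeasure_periodic_unit_cube:
  fixes S :: "(real^'k) set"
  assumes S [measurable]: "S \<in> sets borel" and per: "\<And>x z. x + int_vec z \<in> S \<longleftrightarrow> x \<in> S"
  shows "emeasure lborel (S \<inter> unit_cube_at y) = emeasure lborel (S \<inter> unit_cube_at 0)"
proof -
  define X where "X z = S \<inter> unit_cube_at y \<inter> unit_cube_at (0 + int_vec z)" for z
  define Y where "Y z = S \<inter> unit_cube_at 0 \<inter> unit_cube_at (y - int_vec z)" for z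
  have [measurable]: "X z \<in> sets borel" "Y z \<in> sets borel" for z
    by (auto simp: X_def Y_def)
  have "emeasure lborel (X z) = emeasure lborel (Y z)" for z
  proof -
    have "x \<in> (+) (int_vec z) -` X z \<longleftrightarrow> x \<in> Y z" for x
    proof -
      have "int_vec z + x \<in> unit_cube_at (0 + int_vec z) \<longleftrightarrow> x \<in> unit_cube_at 0"
        using unit_cube_at_add[of x "int_vec z" 0] by (simp add: add.commute)
      then show ?thesis
        using per[of x z] unit_cube_at_plus[of "int_vec z" x y]
        unfolding X_def Y_def by (auto simp del: add_0 simp: add.commute[of _ x])
    qed
    then have "(+) (int_vec z) -` X z = Y z" by blast
    then show ?thesis
      using emeasure_lborel_translate[of "X z" "int_vec z"] by simp
  qed
  moreover have "emeasure lborel (S \<inter> unit_cube_at y) = (\<integral>\<^sup>+z. emeasure lborel (X z) \<partial>count_space UNIV)"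
  proof -
    have "S \<inter> unit_cube_at y = (\<Union>z. X z)"
      using unit_cubes_tile[of _ 0] unfolding X_def by blast
    moreover have "disjoint_family X"
      unfolding disjoint_family_on_def X_def using unit_cubes_tile[of _ 0] by blast
    ultimately show ?thesis
      using emeasure_UN_countable[of UNIV X lborel] by simp
  qed
  moreover have "emeasure lborel (S \<inter> unit_cube_at 0) = (\<integral>\<^sup>+z. emeasure lborel (Y z) \<partial>count_space UNIV)"
  proof -
    have "S \<inter> unit_cube_at 0 = (\<Union>z. Y z)"
      using unit_cubes_tile_minus[of _ y] unfolding Y_def by blast
    moreover have "disjoint_family Y"
      unfolding disjoint_family_on_def Y_def using unit_cubes_tile_minus[of _ y] by blast
    ultimately show ?thesis
      using emeasure_UN_countable[of UNIV Y lborel] by simp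
  qed
  ultimately show ?thesis by simp
qed

lemma to_torus_measurable [measurable]: "to_torus \<in> borel_measurable borel"
  by (rule borel_measurable_continuous_onI[OF continuous_to_torus])

lemma sets_haar [measurable_cong, simp]: "sets haar = sets borel"
  by (simp add: haar_def)

lemma space_haar [simp]: "space haar = UNIV"
  by (simp add: haar_def)

lemma null_hyperplane: "{x :: real^'k. x $ i = c} \<in> null_sets lborel"
proof -
  have "negligible {x :: real^'k. x \<bullet> axis i 1 = c}"
    by (rule negligible_standard_hyperplane) (auto simp: Basis_vec_def)
  then have "{x :: real^'k. x $ i = c} \<in> null_sets lebesgue"
    by (simp add: negligible_iff_null_sets inner_axis)
  moreover have "closed {x :: real^'k. x $ i = c}"
    by (auto intro!: closed_Collect_eq continuous_intros)
  ultimately show ?thesis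
    by (subst (asm) null_sets_completion_iff) auto
qed

lemma mem_cbox_0_1: "x \<in> cbox 0 (1 :: real^'k) \<longleftrightarrow> (\<forall>i. 0 \<le> x $ i \<and> x $ i \<le> 1)"
  by (auto simp: mem_box_cart)

lemma emeasure_cbox_unit_cube:
  fixes S :: "(real^'k) set"
  assumes [measurable]: "S \<in> sets borel"
  shows "emeasure lborel (cbox 0 1 \<inter> S) = emeasure lborel (S \<inter> unit_cube_at 0)"
proof (rule emeasure_eq_AE)
  have "AE x in lborel. \<forall>i\<in>UNIV. (x :: real^'k) $ i \<noteq> 1"
    by (intro AE_ball_countable[THEN iffD2] countable_finite ballI) 
       (auto intro!: AE_I'[OF null_hyperplane[of _ 1]])
  then show "AE x in lborel. (x \<in> cbox 0 1 \<inter> S) = (x \<in> S \<inter> unit_cube_at 0)"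
    by eventually_elim (auto simp: unit_cube_at_def mem_cbox_0_1 less_le)
qed auto

lemma emeasure_lborel_cbox_0_1: "emeasure lborel (cbox 0 (1 :: real^'k)) = 1"
proof -
  have one: "1 \<bullet> b = 1" if "b \<in> Basis" for b :: "real^'k"
    using that by (auto simp: Basis_vec_def inner_axis)
  show ?thesis by (subst emeasure_lborel_cbox) (simp_all add: one)
qed

text \<open>
  The base point of the fundamental domain is arbitrary, which is what makes the translation
  invariance below a statement about Lebesgue measure on the Euclidean space.
\<close>

lemma emeasure_haar:
  fixes A :: "(circle^'k) set"
  assumes A: "A \<in> sets borel"
  shows "emeasure haar A = emeasure lborel (to_torus -` A \<inter> unit_cube_at y)"
proof -
  have [measurable]: "to_torus -` A \<in> sets borel"
    using measurable_sets[OF to_torus_measurable A] by simp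
  have "emeasure haar A = emeasure (uniform_measure lborel (cbox 0 (1 :: real^'k))) (to_torus -` A)"
    unfolding haar_def using A to_torus_measurable
    by (subst emeasure_distr) (simp_all add: uniform_measure_def)
  also have "\<dots> = emeasure lborel (cbox 0 1 \<inter> to_torus -` A)"
    by (subst emeasure_uniform_measure) (simp_all add: emeasure_lborel_cbox_0_1 divide_ennreal_def)
  also have "\<dots> = emeasure lborel (to_torus -` A \<inter> unit_cube_at 0)"
    by (rule emeasure_cbox_unit_cube) simp
  also have "\<dots> = emeasure lborel (to_torus -` A \<inter> unit_cube_at y)"
    by (subst emeasure_periodic_unit_cube[of _ y]) auto
  finally show ?thesis .
qed

lemma torus_add_measurable [measurable]: "(\<lambda>s :: circle^'k. s + h) \<in> borel_measurable borel"
  by (rule borel_measurable_continuous_onI[OF continuous_torus_add])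

lemma emeasure_haar_translate:
  fixes A :: "(circle^'k) set"
  assumes A: "A \<in> sets borel"
  shows "emeasure haar ((\<lambda>s. s + h) -` A) = emeasure haar A"
proof -
  obtain y where y: "to_torus y = h" by (rule to_torus_surj)
  have A': "(\<lambda>s. s + h) -` A \<in> sets borel"
    using measurable_sets[OF torus_add_measurable A] by simp
  have tA: "to_torus -` A \<in> sets borel"
    using measurable_sets[OF to_torus_measurable A] by simp
  have "to_torus -` ((\<lambda>s. s + h) -` A) \<inter> unit_cube_at 0
      = (+) y -` (to_torus -` A \<inter> unit_cube_at y)"
  proof (intro set_eqI)
    fix x
    have "y + x \<in> unit_cube_at y \<longleftrightarrow> x \<in> unit_cube_at 0"
      by (simp add: unit_cube_at_plus)
    moreover have "to_torus (y + x) = to_torus x + h"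
      by (simp only: to_torus_add y add.commute[of h])
    ultimately show "x \<in> to_torus -` ((\<lambda>s. s + h) -` A) \<inter> unit_cube_at 0
      \<longleftrightarrow> x \<in> (+) y -` (to_torus -` A \<inter> unit_cube_at y)" by simp
  qed
  then show ?thesis
    using emeasure_lborel_translate[of "to_torus -` A \<inter> unit_cube_at y" y] tA
    by (simp add: emeasure_haar[OF A', of 0] emeasure_haar[OF A, of y])
qed

lemma distr_haar_translate: "distr haar haar (\<lambda>s :: circle^'k. s + h) = haar"
  by (rule measure_eqI) (auto simp: emeasure_distr emeasure_haar_translate)

interpretation haar: prob_space "haar :: (circle^'k) measure" by (rule prob_space_haar)
interpretation leb: prob_space "leb :: (circle^'k) measure" by (rule prob_space_leb)

lemma space_leb [simp]: "space leb = UNIV" by (simp add: leb_def)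

lemma sets_leb_borel: "A \<in> sets borel \<Longrightarrow> A \<in> sets leb"
  by (simp add: leb_def sets_completionI_sets)

lemma measure_leb_borel: "A \<in> sets borel \<Longrightarrow> measure leb A = measure haar A"
  by (simp add: leb_def)

lemma leb_translate:
  fixes A :: "(circle^'k) set"
  assumes A: "A \<in> sets leb"
  shows "(\<lambda>s. s + h) -` A \<in> sets leb" "measure leb ((\<lambda>s. s + h) -` A) = measure leb A"
proof -
  let ?T = "\<lambda>s :: circle^'k. s + h"
  have m: "?T \<in> completion haar \<rightarrow>\<^sub>M completion haar"
  proof (rule completion.measurable_completion2)
    show "?T \<in> completion haar \<rightarrow>\<^sub>M haar" by (rule measurable_completion) simp
    show "null_sets haar \<subseteq> null_sets (distr (completion haar) haar ?T)"
      by (simp add: distr_completion distr_haar_translate)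
  qed
  then show 1: "?T -` A \<in> sets leb"
    using measurable_sets[OF m, of A] A by (simp add: leb_def)
  have "completion (distr (completion haar) haar ?T) = distr (completion haar) (completion haar) ?T"
    by (rule completion.completion_distr_eq)
       (auto simp: distr_completion distr_haar_translate intro!: measurable_completion)
  then have "distr (completion haar) (completion haar) ?T = completion haar"
    by (simp add: distr_completion distr_haar_translate)
  then have "measure (distr (completion haar) (completion haar) ?T) A = measure leb A"
    by (simp add: leb_def)
  moreover have "measure (distr (completion haar) (completion haar) ?T) A = measure leb (?T -` A)"
    using A by (subst measure_distr[OF m]) (auto simp: leb_def)
  ultimately show "measure leb (?T -` A) = measure leb A" by simp
qed

section \<open>Density of the orbit under multiplication by \<open>p\<close>\<close>

lemma card_vec_box: "card {z :: 'a^'n::finite. \<forall>i. z $ i \<in> S} = card S ^ CARD('n)"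
proof -
  have "bij_betw vec_lambda (UNIV \<rightarrow>\<^sub>E S) {z :: 'a^'n. \<forall>i. z $ i \<in> S}"
    by (rule bij_betw_byWitness[where f' = vec_nth]) auto
  then have "card (UNIV \<rightarrow>\<^sub>E S :: ('n \<Rightarrow> 'a) set) = card {z :: 'a^'n. \<forall>i. z $ i \<in> S}"
    by (rule bij_betw_same_card)
  then show ?thesis by (simp add: card_PiE)
qed

lemma finite_vec_box:
  assumes "finite S" shows "finite {z :: 'a^'n::finite. \<forall>i. z $ i \<in> S}"
proof -
  have "finite (UNIV \<rightarrow>\<^sub>E S :: ('n \<Rightarrow> 'a) set)" using assms by (intro finite_PiE) auto
  then have "finite (vec_lambda ` (UNIV \<rightarrow>\<^sub>E S :: ('n \<Rightarrow> 'a) set))" by simp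
  moreover have "{z :: 'a^'n. \<forall>i. z $ i \<in> S} \<subseteq> vec_lambda ` (UNIV \<rightarrow>\<^sub>E S :: ('n \<Rightarrow> 'a) set)"
    by (auto intro!: image_eqI[of _ _ "vec_nth _"])
  ultimately show ?thesis by (rule finite_subset[rotated])
qed

lemma prod_Basis_vec:
  "(\<Prod>b\<in>(Basis :: ('a::euclidean_space^'n::finite) set). f b) = (\<Prod>d\<in>UNIV. \<Prod>b\<in>Basis. f (axis d b))"
proof -
  have B: "(Basis :: ('a^'n) set) = (\<lambda>(d, b). axis d b) ` (UNIV \<times> Basis)"
    by (auto simp: Basis_vec_def)
  have "inj_on (\<lambda>(d, b). axis d b :: 'a^'n) (UNIV \<times> Basis)"
    by (auto simp: inj_on_def axis_eq_axis)
  then show ?thesis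
    unfolding B by (subst prod.reindex) (auto simp: prod.cartesian_product case_prod_unfold)
qed

lemma vec_lambda_measurable:
  "(\<lambda>f. \<chi> d. f d) \<in> (\<Pi>\<^sub>M d\<in>UNIV. (lborel :: ('a::euclidean_space) measure)) \<rightarrow>\<^sub>M (borel :: ('a^'n::finite) measure)"
proof (subst borel_measurable_euclidean_space, intro ballI)
  fix b :: "'a^'n" assume "b \<in> Basis"
  then obtain d c where b: "b = axis d c" "c \<in> Basis" by (auto simp: Basis_vec_def)
  have "(\<lambda>f. f d) \<in> (\<Pi>\<^sub>M d\<in>(UNIV :: 'n set). (lborel :: 'a measure)) \<rightarrow>\<^sub>M lborel"
    by (rule measurable_component_singleton) simp
  then have "(\<lambda>f. f d \<bullet> c) \<in> (\<Pi>\<^sub>M d\<in>(UNIV :: 'n set). (lborel :: 'a measure)) \<rightarrow>\<^sub>M borel"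
    by (intro borel_measurable_inner) auto
  then show "(\<lambda>f. (\<chi> d. f d) \<bullet> b) \<in> borel_measurable (\<Pi>\<^sub>M d\<in>(UNIV :: 'n set). (lborel :: 'a measure))"
    by (simp add: b inner_axis)
qed

text \<open>
  The scaling argument below needs a Euclidean space, whereas the rotation angles are distributed
  according to a product of Haar measures. This is the bridge between the two.
\<close>

lemma lborel_vec_eq_distr_PiM:
  "(lborel :: ('a::euclidean_space^'n::finite) measure)
     = distr (\<Pi>\<^sub>M d\<in>UNIV. lborel) borel (\<lambda>f. \<chi> d. f d)"
proof (rule lborel_eqI)
  interpret product_sigma_finite "\<lambda>_ :: 'n. lborel :: 'a measure" by standard
  fix l u :: "'a^'n" assume le: "\<And>b. b \<in> Basis \<Longrightarrow> l \<bullet> b \<le> u \<bullet> b"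
  have le': "l $ d \<bullet> b \<le> u $ d \<bullet> b" if "b \<in> Basis" for d b
    using le[of "axis d b"] that by (auto simp: Basis_vec_def inner_axis)
  have eq: "(\<lambda>f. \<chi> d. f d) -` box l u \<inter> space (\<Pi>\<^sub>M d\<in>UNIV. lborel) = (\<Pi>\<^sub>E d\<in>UNIV. box (l $ d) (u $ d))"
    by (auto simp: space_PiM box_def Basis_vec_def inner_axis PiE_iff)
  show "emeasure (distr (\<Pi>\<^sub>M d\<in>UNIV. lborel) borel (\<lambda>f. \<chi> d. f d)) (box l u) = (\<Prod>b\<in>Basis. (u - l) \<bullet> b)"
    using le' by (subst emeasure_distr[OF vec_lambda_measurable])
       (simp_all add: eq emeasure_PiM emeasure_lborel_box_eq prod_Basis_vec inner_axis
         prod_ennreal prod_nonneg inner_diff_left)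
qed simp

lemma emeasure_lborel_vec_box:
  fixes X :: "'n::finite \<Rightarrow> ('a::euclidean_space) set"
  assumes "\<And>d. X d \<in> sets borel"
  shows "{x :: 'a^'n. \<forall>d. x $ d \<in> X d} \<in> sets borel"
    and "emeasure lborel {x :: 'a^'n. \<forall>d. x $ d \<in> X d} = (\<Prod>d\<in>UNIV. emeasure lborel (X d))"
proof -
  interpret product_sigma_finite "\<lambda>_ :: 'n. lborel :: 'a measure" by standard
  have m: "(\<lambda>x :: 'a^'n. x $ d) -` X d \<in> sets borel" for d
    using assms[of d] by (intro measurable_sets_borel[of "\<lambda>x. x $ d" borel]
       borel_measurable_continuous_onI continuous_intros) auto
  have "{x :: 'a^'n. \<forall>d. x $ d \<in> X d} = (\<Inter>d. (\<lambda>x. x $ d) -` X d)" by auto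
  also have "\<dots> \<in> sets borel" using m by (intro sets.finite_INT) auto
  finally show *: "{x :: 'a^'n. \<forall>d. x $ d \<in> X d} \<in> sets borel" .
  have eq: "(\<lambda>f. \<chi> d. f d) -` {x :: 'a^'n. \<forall>d. x $ d \<in> X d} \<inter> space (\<Pi>\<^sub>M d\<in>UNIV. lborel) = (\<Pi>\<^sub>E d\<in>UNIV. X d)"
    by (auto simp: space_PiM PiE_iff)
  show "emeasure lborel {x :: 'a^'n. \<forall>d. x $ d \<in> X d} = (\<Prod>d\<in>UNIV. emeasure lborel (X d))"
    unfolding lborel_vec_eq_distr_PiM emeasure_distr[OF vec_lambda_measurable *] eq
    using assms by (subst emeasure_PiM) auto
qed

definition to_tori :: "real^'k^'d \<Rightarrow> 'd \<Rightarrow> circle^'k" where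
  "to_tori x d = to_torus (x $ d)"

definition tori_cube :: "(real^'k^'d) set" where
  "tori_cube = {x. \<forall>d. x $ d \<in> unit_cube_at 0}"

lemma tori_cube_borel [measurable]: "tori_cube \<in> sets borel"
  unfolding tori_cube_def by (rule emeasure_lborel_vec_box(1)) simp

lemma emeasure_tori_cube: "emeasure lborel (tori_cube :: (real^'k^'d) set) = 1"
proof -
  have "emeasure lborel (unit_cube_at (0 :: real^'k)) = emeasure lborel (cbox 0 (1 :: real^'k))"
    using emeasure_cbox_unit_cube[of "UNIV :: (real^'k) set"] by simp
  then show ?thesis unfolding tori_cube_def
    by (subst emeasure_lborel_vec_box(2)) (simp_all add: emeasure_lborel_cbox_0_1)
qed

lemma to_tori_measurable:
  "to_tori \<in> borel \<rightarrow>\<^sub>M (\<Pi>\<^sub>M d\<in>(UNIV :: 'd::finite set). (haar :: (circle^'k::finite) measure))"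
proof (rule measurable_PiM_single')
  fix d :: 'd
  have "(\<lambda>x :: real^'k^'d. x $ d) \<in> borel_measurable borel"
    by (intro borel_measurable_continuous_onI continuous_intros)
  then have "(\<lambda>x :: real^'k^'d. to_torus (x $ d)) \<in> borel_measurable borel"
    by (rule measurable_compose[OF _ to_torus_measurable])
  then show "(\<lambda>x :: real^'k^'d. to_tori x d) \<in> borel \<rightarrow>\<^sub>M haar"
    unfolding to_tori_def by (simp cong: measurable_cong_sets)
qed auto

lemma PiM_haar_eq_distr:
  "(\<Pi>\<^sub>M d\<in>(UNIV :: 'd::finite set). (haar :: (circle^'k::finite) measure))
    = distr (restrict_space lborel tori_cube) (\<Pi>\<^sub>M d\<in>UNIV. haar) to_tori"
proof -
  interpret product_sigma_finite "\<lambda>_ :: 'd. haar :: (circle^'k) measure" by standard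
  have m: "to_tori \<in> restrict_space lborel tori_cube \<rightarrow>\<^sub>M (\<Pi>\<^sub>M d\<in>(UNIV :: 'd set). (haar :: (circle^'k) measure))"
    using to_tori_measurable by (intro measurable_restrict_space1) simp
  show ?thesis
  proof (rule PiM_eqI[symmetric])
    fix A :: "'d \<Rightarrow> (circle^'k) set"
    assume "\<And>d. d \<in> UNIV \<Longrightarrow> A d \<in> sets haar"
    then have A: "A d \<in> sets borel" for d by simp
    then have tA: "to_torus -` A d \<inter> unit_cube_at 0 \<in> sets borel" for d
      using measurable_sets[OF to_torus_measurable A] by (intro sets.Int) auto
    have "emeasure (distr (restrict_space lborel tori_cube) (\<Pi>\<^sub>M d\<in>UNIV. haar) to_tori) (\<Pi>\<^sub>E d\<in>UNIV. A d)
      = emeasure (restrict_space lborel tori_cube)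
          (to_tori -` (\<Pi>\<^sub>E d\<in>UNIV. A d) \<inter> space (restrict_space lborel tori_cube))"
      using A by (intro emeasure_distr[OF m] sets_PiM_I_finite) auto
    also have "\<dots> = emeasure lborel (to_tori -` (\<Pi>\<^sub>E d\<in>UNIV. A d) \<inter> space (restrict_space lborel tori_cube))"
      by (subst emeasure_restrict_space) (auto simp: space_restrict_space)
    also have "to_tori -` (\<Pi>\<^sub>E d\<in>UNIV. A d) \<inter> space (restrict_space lborel tori_cube)
       = {x. \<forall>d. x $ d \<in> to_torus -` A d \<inter> unit_cube_at 0}"
      by (auto simp: space_restrict_space tori_cube_def to_tori_def PiE_iff)
    also have "emeasure lborel \<dots> = (\<Prod>d\<in>UNIV. emeasure haar (A d))"
      using tA A by (subst emeasure_lborel_vec_box(2)) (auto simp: emeasure_haar[where y = 0])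
    finally show "emeasure (distr (restrict_space lborel tori_cube) (\<Pi>\<^sub>M d\<in>UNIV. haar) to_tori) (\<Pi>\<^sub>E d\<in>UNIV. A d)
       = (\<Prod>d\<in>UNIV. emeasure haar (A d))" .
  qed auto
qed

definition near_at :: "nat \<Rightarrow> real \<Rightarrow> ('d \<Rightarrow> circle^'k) \<Rightarrow> nat \<Rightarrow> ('d \<Rightarrow> circle^'k) \<Rightarrow> bool" where
  "near_at p e y m \<alpha> \<longleftrightarrow> (\<forall>d. tnorm (tmult (int p ^ m) (\<alpha> d) - y d) < e)"

lemma near_at_measurable [measurable]:
  "{\<alpha>. near_at p e y m \<alpha>} \<in> sets (\<Pi>\<^sub>M d\<in>(UNIV :: 'd::finite set). (haar :: (circle^'k::finite) measure))"
proof -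
  have o: "{s. tnorm (tmult (int p ^ m) s - y d) < e} \<in> sets haar" for d
    using open_vimage[OF open_tnorm_ball continuous_tmult, of "int p ^ m" "y d" e] by (simp add: vimage_def)
  have "(\<lambda>\<alpha>. \<alpha> d) -` {s. tnorm (tmult (int p ^ m) s - y d) < e} \<inter> space (\<Pi>\<^sub>M d\<in>(UNIV :: 'd set). (haar :: (circle^'k) measure))
     \<in> sets (\<Pi>\<^sub>M d\<in>(UNIV :: 'd set). (haar :: (circle^'k) measure))" for d
    by (rule measurable_sets[OF _ o]) (rule measurable_component_singleton, simp)
  then have "(\<Inter>d. (\<lambda>\<alpha>. \<alpha> d) -` {s. tnorm (tmult (int p ^ m) s - y d) < e} \<inter> space (\<Pi>\<^sub>M d\<in>(UNIV :: 'd set). (haar :: (circle^'k) measure)))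
     \<in> sets (\<Pi>\<^sub>M d\<in>(UNIV :: 'd set). (haar :: (circle^'k) measure))"
    by (intro sets.finite_INT) auto
  also have "(\<Inter>d. (\<lambda>\<alpha>. \<alpha> d) -` {s. tnorm (tmult (int p ^ m) s - y d) < e} \<inter> space (\<Pi>\<^sub>M d\<in>(UNIV :: 'd set). (haar :: (circle^'k) measure)))
    = {\<alpha>. near_at p e y m \<alpha>}"
    by (auto simp: near_at_def space_PiM)
  finally show ?thesis .
qed

lemma lborel_scale_vimage:
  fixes E :: "('a::euclidean_space) set"
  assumes "E \<in> sets borel" "c > 0"
  shows "measure lborel {x. t + c *\<^sub>R x \<in> E} = measure lborel E / c ^ DIM('a)"
    and "emeasure lborel E < \<infinity> \<Longrightarrow> {x. t + c *\<^sub>R x \<in> E} \<in> fmeasurable lborel"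
proof -
  have m: "{x. t + c *\<^sub>R x \<in> E} \<in> sets borel"
    using assms measurable_sets_borel[of "\<lambda>x. t + c *\<^sub>R x" borel E] by (auto simp: vimage_def)
  have "emeasure lborel E = emeasure (density (distr lborel borel (\<lambda>x. t + c *\<^sub>R x)) (\<lambda>_. \<bar>c\<bar>^DIM('a))) E"
    using assms lborel_affine[of c t] by simp
  also have "\<dots> = ennreal (c ^ DIM('a)) * emeasure lborel {x. t + c *\<^sub>R x \<in> E}"
    using assms by (subst emeasure_density)
      (auto simp: nn_integral_cmult_indicator emeasure_distr vimage_def)
  finally have eq: "emeasure lborel E = ennreal (c ^ DIM('a)) * emeasure lborel {x. t + c *\<^sub>R x \<in> E}" .
  then have "measure lborel E = c ^ DIM('a) * measure lborel {x. t + c *\<^sub>R x \<in> E}"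
    using assms unfolding measure_def by (simp add: enn2real_mult)
  then show "measure lborel {x. t + c *\<^sub>R x \<in> E} = measure lborel E / c ^ DIM('a)"
    using assms by (simp add: field_simps)
  show "{x. t + c *\<^sub>R x \<in> E} \<in> fmeasurable lborel" if "emeasure lborel E < \<infinity>"
    using that eq m assms by (intro fmeasurableI) (auto simp: ennreal_mult_less_top)
qed

text \<open>
  The vector \<open>w\<close> is the first digit of \<open>x\<close> in base \<open>q\<close>; the difference is the rest of the expansion,
  shifted by one place.
\<close>

lemma unit_cube_digits:
  fixes x :: "real^'k" and q :: nat
  assumes "x \<in> unit_cube_at 0" "q > 0"
  obtains w where "\<And>i. w $ i \<in> {0..<int q}" "real q *\<^sub>R x - int_vec w \<in> unit_cube_at 0"
proof
  let ?w = "\<chi> i. \<lfloor>real q * x $ i\<rfloor>"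
  have x: "0 \<le> x $ i" "x $ i < 1" for i using assms(1) by (auto simp: unit_cube_at_def)
  show "?w $ i \<in> {0..<int q}" for i
  proof -
    have "real q * x $ i < real q" using x[of i] assms(2) by simp
    then show ?thesis using x[of i] by (auto simp: floor_less_iff)
  qed
  show "real q *\<^sub>R x - int_vec ?w \<in> unit_cube_at 0"
    unfolding unit_cube_at_def
  proof (intro CollectI allI)
    fix i
    show "(0 :: real^'k) $ i \<le> (real q *\<^sub>R x - int_vec ?w) $ i \<and> (real q *\<^sub>R x - int_vec ?w) $ i < (0 :: real^'k) $ i + 1"
      using floor_correct[of "real q * x $ i"] by (simp, linarith)
  qed
qed

lemma unit_cube_digits_close:
  fixes x :: "real^'k" and q :: nat
  assumes "real q *\<^sub>R x - int_vec w \<in> unit_cube_at 0" "q > 0"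
  shows "\<bar>(x - (1 / real q) *\<^sub>R int_vec w) $ i\<bar> < 1 / real q"
proof -
  have "0 \<le> real q * x $ i - w $ i" "real q * x $ i - w $ i < 1"
    using assms(1) by (auto simp: unit_cube_at_def)
  then have "\<bar>(real q * x $ i - w $ i) / real q\<bar> < 1 / real q"
    using assms(2) by (simp add: divide_strict_right_mono)
  then show ?thesis using assms(2) by (simp add: diff_divide_distrib)
qed

text \<open>
  Let \<open>E\<close> be the set of points whose orbit never comes close to the corner of the cell with digit
  \<open>v\<close>. A point of \<open>E\<close> does not have first digit \<open>v\<close> in base \<open>q\<close>, as it would then itself be close to
  that corner, and removing its first digit amounts to multiplication by \<open>q = p\<^sup>r\<close>, which leads back
  to \<open>E\<close>. So \<open>E\<close> is covered by copies of
  itself scaled by \<open>1 / q\<close>, one for each digit other than \<open>v\<close>. With \<open>n\<close> digits in all, the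
  measure of \<open>E\<close> is at most \<open>(n - 1) / n\<close> times itself, hence zero.
\<close>

lemma null_avoiding_cell:
  fixes v :: "int^'k::finite^'d::finite" and p r :: nat
  assumes p: "p > 0" and v: "\<And>d i. v $ d $ i \<in> {0..<int (p ^ r)}"
  defines "q \<equiv> p ^ r"
  defines "E \<equiv> tori_cube \<inter> {x :: real^'k^'d. \<forall>m. \<not> near_at p (1 / real q) (\<lambda>d. to_torus ((1 / real q) *\<^sub>R int_vec (v $ d))) m (to_tori x)}"
  shows "E \<in> null_sets lborel"
proof -
  let ?y = "\<lambda>d. to_torus ((1 / real q) *\<^sub>R int_vec (v $ d))"
  have q: "q > 0" using p by (simp add: q_def)
  have [measurable]: "to_tori -` {\<alpha>. near_at p e y m \<alpha>} \<in> sets borel" for e m and y :: "'d \<Rightarrow> circle^'k"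
    using measurable_sets[OF to_tori_measurable near_at_measurable[of p e y m]] by simp
  have E_eq: "E = tori_cube - (\<Union>m. to_tori -` {\<alpha>. near_at p (1 / real q) ?y m \<alpha>})"
    by (auto simp: E_def)
  have E [measurable]: "E \<in> sets borel" unfolding E_eq by measurable
  have E_le: "emeasure lborel E \<le> 1"
    using emeasure_mono[of E tori_cube lborel] by (simp add: E_eq emeasure_tori_cube)
  then have E_fin: "emeasure lborel E < \<infinity>" by (auto simp: order_le_less_trans)
  define V where "V = {w :: int^'k^'d. \<forall>d. w $ d \<in> {u. \<forall>i. u $ i \<in> {0..<int q}}}"
  have cV: "card V = (q ^ CARD('k)) ^ CARD('d)"
    unfolding V_def by (simp only: card_vec_box card_atLeastLessThan_int) simp
  have fV: "finite V"
    unfolding V_def by (intro finite_vec_box) auto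
  have vV: "v \<in> V" using v by (auto simp: V_def q_def)
  define t where "t w = - (\<chi> d. int_vec (w $ d))" for w :: "int^'k^'d"
  \<comment> \<open>\<open>V\<close> is the set of digits; the preimage for the digit \<open>w\<close> is the scaled copy of \<open>E\<close> in the cell of \<open>w\<close>.\<close>
  have sub: "E \<subseteq> (\<Union>w\<in>V - {v}. {x. t w + real q *\<^sub>R x \<in> E})"
  proof
    fix x assume x: "x \<in> E"
    then have "\<forall>d. x $ d \<in> unit_cube_at 0" by (auto simp: E_def tori_cube_def)
    then have "\<forall>d. \<exists>w. (\<forall>i. w $ i \<in> {0..<int q}) \<and> real q *\<^sub>R x $ d - int_vec w \<in> unit_cube_at 0"
      using unit_cube_digits[OF _ q] by metis
    then obtain f where f: "\<And>d i. f d $ i \<in> {0..<int q}" "\<And>d. real q *\<^sub>R x $ d - int_vec (f d) \<in> unit_cube_at 0"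
      by metis
    define w where "w = (\<chi> d. f d)"
    have wV: "w \<in> V" using f(1) by (auto simp: V_def w_def)
    let ?x' = "t w + real q *\<^sub>R x"
    have x'_nth: "?x' $ d = real q *\<^sub>R x $ d - int_vec (w $ d)" for d
      by (simp add: t_def)
    have cube: "?x' $ d \<in> unit_cube_at 0" for d unfolding x'_nth using f(2)[of d] by (simp add: w_def)
    have tori: "tmult (int p ^ m) (to_tori ?x' d) = tmult (int p ^ (m + r)) (to_tori x d)" for m d
    proof -
      have "to_tori ?x' d = tmult (int q) (to_tori x d)"
        unfolding to_tori_def x'_nth tmult_to_torus
        using to_torus_int_vec[of "real q *\<^sub>R x $ d" "- w $ d"]
        by (simp add: int_vec_def vec_eq_iff to_torus_def)
      then show ?thesis by (simp add: q_def power_add tmult_mult)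
    qed
    have "near_at p e y (m + r) (to_tori x)" if "near_at p e y m (to_tori ?x')" for e y m
      using that by (simp add: near_at_def tori)
    then have "?x' \<in> E" using x cube unfolding E_def tori_cube_def by blast
    moreover have "w \<noteq> v"
    proof
      assume "w = v"
      have "\<bar>(x $ d - (1 / real q) *\<^sub>R int_vec (v $ d)) $ i\<bar> < 1 / real q" for d i
        using unit_cube_digits_close[OF _ q] cube[of d] \<open>w = v\<close> unfolding x'_nth by blast
      then have "near_at p (1 / real q) ?y 0 (to_tori x)"
        unfolding near_at_def
        by (auto simp: to_tori_def tmult_to_torus intro!: tnorm_to_torus_less simp flip: to_torus_diff)
      then show False using x by (auto simp: E_def)
    qed
    ultimately show "x \<in> (\<Union>w\<in>V - {v}. {x. t w + real q *\<^sub>R x \<in> E})" using wV by blast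
  qed
  have N: "DIM(real^'k^'d) = CARD('k) * CARD('d)" by simp
  let ?N = "CARD('k) * CARD('d)"
  have "measure lborel E \<le> measure lborel (\<Union>w\<in>V - {v}. {x. t w + real q *\<^sub>R x \<in> E})"
    using lborel_scale_vimage(2)[OF E _ E_fin, of "real q"] q fV E
    by (intro measure_mono_fmeasurable sub fmeasurable.finite_UN) auto
  also have "\<dots> \<le> (\<Sum>w\<in>V - {v}. measure lborel {x. t w + real q *\<^sub>R x \<in> E})"
    using lborel_scale_vimage(2)[OF E _ E_fin, of "real q"] q fV
    by (intro measure_UNION_le) (auto dest: fmeasurableD)
  also have "\<dots> = (\<Sum>w\<in>V - {v}. measure lborel E / real q ^ ?N)"
    using lborel_scale_vimage(1)[OF E, of "real q"] q by (simp add: N mult.commute)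
  also have "\<dots> = (real q ^ ?N - 1) * (measure lborel E / real q ^ ?N)"
    using vV fV q by (simp add: cV card_Diff_singleton power_mult of_nat_diff)
  also have "\<dots> = measure lborel E - measure lborel E / real q ^ ?N"
    using q by (simp add: field_simps)
  finally have "measure lborel E \<le> 0"
  proof -
    assume "measure lborel E \<le> measure lborel E - measure lborel E / real q ^ ?N"
    moreover have "real q ^ ?N > 0" using q by (intro zero_less_power) simp
    ultimately show "measure lborel E \<le> 0" by (simp add: divide_le_0_iff)
  qed
  then have "measure lborel E = 0" by (simp add: measure_le_0_iff)
  then show ?thesis
    using E_fin by (auto simp: null_sets_def measure_def enn2real_eq_0_iff)
qed

definition dense_orbit :: "nat \<Rightarrow> ('d \<Rightarrow> circle^'k) \<Rightarrow> bool" where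
  "dense_orbit p \<alpha> \<longleftrightarrow> (\<forall>y. \<forall>e>0. \<exists>m. near_at p e y m \<alpha>)"

text \<open>
  There are countably many cells of the form considered above, and they become arbitrarily small.
\<close>

lemma AE_dense_orbit:
  assumes p: "p \<ge> 2"
  shows "AE \<alpha> in (\<Pi>\<^sub>M d\<in>(UNIV :: 'd::finite set). (haar :: (circle^'k::finite) measure)). dense_orbit p \<alpha>"
proof -
  let ?y = "\<lambda>r (v :: int^'k^'d) d. to_torus ((1 / real (p ^ r)) *\<^sub>R int_vec (v $ d))"
  have "AE \<alpha> in (\<Pi>\<^sub>M d\<in>(UNIV :: 'd::finite set). (haar :: (circle^'k::finite) measure)).
      (\<forall>d i. v $ d $ i \<in> {0..<int (p ^ r)}) \<longrightarrow> (\<exists>m. near_at p (1 / real (p ^ r)) (?y r v) m \<alpha>)" for r v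
  proof (cases "\<forall>d i. v $ d $ i \<in> {0..<int (p ^ r)}")
    case True
    let ?S = "{\<alpha>. \<exists>m. near_at p (1 / real (p ^ r)) (?y r v) m \<alpha>}"
    have S: "?S \<in> sets (\<Pi>\<^sub>M d\<in>(UNIV :: 'd::finite set). (haar :: (circle^'k::finite) measure))"
    proof -
      have "?S = (\<Union>m. {\<alpha>. near_at p (1 / real (p ^ r)) (?y r v) m \<alpha>})" by auto
      then show ?thesis by (simp add: near_at_measurable sets.countable_UN)
    qed
    have m: "to_tori \<in> restrict_space lborel tori_cube \<rightarrow>\<^sub>M (\<Pi>\<^sub>M d\<in>(UNIV :: 'd set). (haar :: (circle^'k) measure))"
      using to_tori_measurable by (intro measurable_restrict_space1) simp
    have "AE x in lborel. x \<in> tori_cube \<longrightarrow> (\<exists>m. near_at p (1 / real (p ^ r)) (?y r v) m (to_tori x))"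
      using True p by (intro AE_I'[OF null_avoiding_cell[of p v r]]) auto
    then have "AE x in restrict_space lborel tori_cube. \<exists>m. near_at p (1 / real (p ^ r)) (?y r v) m (to_tori x)"
      by (subst AE_restrict_space_iff) auto
    then have "AE \<alpha> in (\<Pi>\<^sub>M d\<in>(UNIV :: 'd::finite set). (haar :: (circle^'k::finite) measure)).
        (\<exists>m. near_at p (1 / real (p ^ r)) (?y r v) m \<alpha>)"
      using S by (subst PiM_haar_eq_distr, subst AE_distr_iff[OF m]) (auto simp: space_PiM PiE_def)
    then show ?thesis by eventually_elim auto
  qed auto
  then have "AE \<alpha> in (\<Pi>\<^sub>M d\<in>(UNIV :: 'd::finite set). (haar :: (circle^'k::finite) measure)).
     \<forall>r v. (\<forall>d i. v $ d $ i \<in> {0..<int (p ^ r)}) \<longrightarrow> (\<exists>m. near_at p (1 / real (p ^ r)) (?y r v) m \<alpha>)"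
    by (simp only: AE_all_countable) blast
  then show ?thesis
  proof eventually_elim
    fix \<alpha> :: "'d \<Rightarrow> circle^'k"
    assume *: "\<forall>r v. (\<forall>d i. v $ d $ i \<in> {0..<int (p ^ r)}) \<longrightarrow> (\<exists>m. near_at p (1 / real (p ^ r)) (?y r v) m \<alpha>)"
    show "dense_orbit p \<alpha>"
      unfolding dense_orbit_def
    proof (intro allI impI)
      fix y :: "'d \<Rightarrow> circle^'k" and e :: real
      assume e: "e > 0"
      obtain r where r: "1 / real (p ^ r) < e / 2"
      proof -
        obtain r where "2 / e < real p ^ r" using real_arch_pow[of "real p" "2 / e"] p by auto
        then show ?thesis using e p that[of r] by (simp add: field_simps)
      qed
      \<comment> \<open>The cell of size \<open>1 / q\<close> that contains \<open>y\<close> has its corner within \<open>1 / q\<close> of \<open>y\<close>.\<close>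
      define q where "q = p ^ r"
      have q: "q > 0" using p by (simp add: q_def)
      have "\<exists>z. to_torus z = s \<and> z \<in> unit_cube_at 0" for s :: "circle^'k"
      proof -
        obtain x where x: "to_torus x = s" by (rule to_torus_surj)
        obtain w where "x \<in> unit_cube_at (0 + int_vec w)" using unit_cubes_tile[of x 0] by blast
        then have "x + int_vec (- w) \<in> unit_cube_at 0"
          by (simp add: unit_cube_at_def int_vec_def algebra_simps)
        then show ?thesis using x by (intro exI[of _ "x + int_vec (- w)"]) simp
      qed
      then have "\<forall>d. \<exists>z. to_torus z = y d \<and> z \<in> unit_cube_at 0" by blast
      then obtain z where z: "\<And>d. to_torus (z d) = y d" "\<And>d. z d \<in> unit_cube_at 0" by metis
      have "\<forall>d. \<exists>w. (\<forall>i. w $ i \<in> {0..<int q}) \<and> real q *\<^sub>R z d - int_vec w \<in> unit_cube_at 0"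
        using unit_cube_digits[OF z(2) q] by metis
      then obtain f where f: "\<And>d i. f d $ i \<in> {0..<int q}" "\<And>d. real q *\<^sub>R z d - int_vec (f d) \<in> unit_cube_at 0"
        by metis
      obtain m where m: "near_at p (1 / real q) (?y r (\<chi> d. f d)) m \<alpha>"
        using *[rule_format, of "\<chi> d. f d" r] f(1) by (auto simp: q_def)
      have close: "tnorm (?y r (\<chi> d. f d) d - y d) < 1 / real q" for d
      proof -
        have "\<bar>(z d - (1 / real q) *\<^sub>R int_vec (f d)) $ i\<bar> < 1 / real q" for i
          by (rule unit_cube_digits_close[OF f(2) q])
        then have "tnorm (to_torus (z d - (1 / real q) *\<^sub>R int_vec (f d))) < 1 / real q"
          by (rule tnorm_to_torus_less)
        then show ?thesis
          by (subst tnorm_minus_commute) (simp add: to_torus_diff z(1) q_def)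
      qed
      have "tnorm (tmult (int p ^ m) (\<alpha> d) - y d) < e" for d
      proof -
        have "tnorm (tmult (int p ^ m) (\<alpha> d) - y d) < 1 / real q + 1 / real q"
          using m close[of d] by (intro tnorm_triangle_less) (auto simp: near_at_def)
        then show ?thesis using r by (simp add: q_def)
      qed
      then show "\<exists>m. near_at p e y m \<alpha>" unfolding near_at_def by blast
    qed
  qed
qed

section \<open>Injectivity, dense image and return times\<close>

definition lat_scale :: "int \<Rightarrow> int^'d \<Rightarrow> int^'d" where
  "lat_scale n b = (\<chi> d. n * b $ d)"

lemma tmult_commute: "tmult m (tmult n s) = tmult n (tmult m s)"
  by (metis tmult_mult mult.commute)

lemma tau_axis: "tau \<alpha> (axis d n) = tmult n (\<alpha> d)"
proof -
  have "tau \<alpha> (axis d n) = (\<Sum>d'\<in>UNIV. if d' = d then tmult n (\<alpha> d') else 0)"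
    unfolding tau_eq by (rule sum.cong) (auto simp: axis_def)
  then show ?thesis by simp
qed

lemma tau_lat_scale: "tau \<alpha> (lat_scale n b) = (\<Sum>d\<in>UNIV. tmult (b $ d) (tmult n (\<alpha> d)))"
  unfolding tau_eq lat_scale_def by (simp add: tmult_mult tmult_commute)

text \<open>
  The multiples \<open>p\<^sup>m \<alpha>\<^sub>d\<close> for one fixed \<open>d\<close> are values of \<open>\<tau>\<close>, and they are already dense.
\<close>

lemma dense_orbit_tau_dense:
  fixes \<alpha> :: "'d::finite \<Rightarrow> circle^'k"
  assumes "dense_orbit p \<alpha>" "e > 0"
  obtains l where "tnorm (tau \<alpha> l - s) < e"
proof -
  obtain m where m: "near_at p e (\<lambda>_. s) m \<alpha>" using assms unfolding dense_orbit_def by blast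
  fix d :: 'd
  have "tnorm (tau \<alpha> (axis d (int p ^ m)) - s) < e"
    using m unfolding near_at_def tau_axis by blast
  then show ?thesis by (rule that)
qed

lemma closure_range_tau:
  fixes \<alpha> :: "'d::finite \<Rightarrow> circle^'k"
  assumes "dense_orbit p \<alpha>"
  shows "closure (range (tau \<alpha>)) = UNIV"
proof -
  have "s \<in> closure (range (tau \<alpha>))" for s
    unfolding closure_iff_nhds_not_empty
  proof (intro allI impI)
    fix A S assume A: "S \<subseteq> A" "open S" "s \<in> S"
    obtain e where e: "e > 0" "\<And>t. tnorm (t - s) < e \<Longrightarrow> t \<in> S"
      using open_torus_ball[OF A(2,3)] by blast
    obtain l where "tnorm (tau \<alpha> l - s) < e" using dense_orbit_tau_dense[OF assms e(1)] .
    then show "range (tau \<alpha>) \<inter> A \<noteq> {}" using e(2) A(1) by blast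
  qed
  then show ?thesis by blast
qed

lemma cnorm_half: "cnorm (abs_circle (1 / 2)) = 1 / 2"
  by (simp add: cnorm.abs_eq round_def)

text \<open>
  A nontrivial relation between the angles would be inherited by all points \<open>p\<^sup>m \<alpha>\<close>, hence, by
  density, by all points of the torus up to an arbitrarily small error. The point \<open>y\<close> in the proof
  violates it by \<open>1 / 2\<close>, the largest value possible on the circle.
\<close>

lemma inj_tau:
  fixes \<alpha> :: "'d::finite \<Rightarrow> circle^'k"
  assumes "dense_orbit p \<alpha>"
  shows "inj (tau \<alpha>)"
proof -
  have *: "b = 0" if "tau \<alpha> b = 0" for b
  proof (rule ccontr)
    assume "b \<noteq> 0"
    then obtain d0 where d0: "b $ d0 \<noteq> 0" by (auto simp: vec_eq_iff)
    define h where "h = (to_torus (\<chi> i. 1 / 2) :: circle^'k)"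
    define y where "y d = (if d = d0 then to_torus (\<chi> i. 1 / (2 * b $ d0)) else (0 :: circle^'k))" for d
    have hy: "(\<Sum>d\<in>UNIV. tmult (b $ d) (y d)) = h"
    proof -
      have "(\<Sum>d\<in>UNIV. tmult (b $ d) (y d)) = (\<Sum>d\<in>UNIV. if d = d0 then tmult (b $ d0) (y d0) else 0)"
        by (rule sum.cong) (auto simp: y_def)
      also have "\<dots> = tmult (b $ d0) (y d0)" by simp
      also have "\<dots> = h" using d0
        by (simp add: y_def h_def tmult_to_torus) (simp add: to_torus_def vec_eq_iff)
      finally show ?thesis .
    qed
    define c where "c = (\<Sum>d\<in>UNIV. \<bar>real_of_int (b $ d)\<bar>)"
    have c: "c \<ge> 0" by (auto simp: c_def intro: sum_nonneg)
    obtain m where m: "near_at p (1 / (2 * (c + 1))) y m \<alpha>"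
      using assms c unfolding dense_orbit_def by (metis divide_pos_pos zero_less_one add_nonneg_pos mult_pos_pos zero_less_numeral)
    have "(\<Sum>d\<in>UNIV. tmult (b $ d) (tmult (int p ^ m) (\<alpha> d))) = tmult (int p ^ m) (tau \<alpha> b)"
      by (simp add: tau_eq tmult_sum tmult_commute)
    then have "h = - (\<Sum>d\<in>UNIV. tmult (b $ d) (tmult (int p ^ m) (\<alpha> d) - y d))"
      using that hy by (simp add: tmult_diff_right sum_subtractf)
    then have "tnorm h = tnorm (\<Sum>d\<in>UNIV. tmult (b $ d) (tmult (int p ^ m) (\<alpha> d) - y d))"
      by simp
    also have "\<dots> \<le> (\<Sum>d\<in>UNIV. \<bar>real_of_int (b $ d)\<bar> * (1 / (2 * (c + 1))))"
      using m unfolding near_at_def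
      by (intro order_trans[OF tnorm_sum_le] sum_mono order_trans[OF tnorm_tmult_le] mult_left_mono)
         (auto intro: less_imp_le)
    also have "\<dots> = c * (1 / (2 * (c + 1)))" unfolding sum_distrib_right[symmetric] c_def ..
    also have "\<dots> < 1 / 2" using c by (simp add: field_simps)
    finally have "tnorm h < 1 / 2" .
    then have "cnorm (h $ i) < 1 / 2" for i by (simp only: tnorm_less_iff)
    then show False by (simp add: h_def to_torus_def cnorm_half)
  qed
  show ?thesis
  proof (rule injI)
    fix l l' assume "tau \<alpha> l = tau \<alpha> l'"
    then show "l = l'" using *[of "l - l'"] by (simp add: tau_diff)
  qed
qed

lemma dense_orbit_return_times:
  fixes \<alpha> :: "'d::finite \<Rightarrow> circle^'k"
  assumes "dense_orbit p \<alpha>"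
  obtains m where "\<And>b. (\<lambda>j. tnorm (tau \<alpha> (lat_scale (int p ^ m j) b))) \<longlonglongrightarrow> 0"
proof -
  have "\<exists>m. near_at p (1 / real (Suc j)) (\<lambda>_. 0) m \<alpha>" for j
    using assms unfolding dense_orbit_def by simp
  then obtain m where m: "\<And>j. near_at p (1 / real (Suc j)) (\<lambda>_. 0) (m j) \<alpha>" by metis
  have "(\<lambda>j. tnorm (tau \<alpha> (lat_scale (int p ^ m j) b))) \<longlonglongrightarrow> 0" for b
  proof (rule tendsto_sandwich[of "\<lambda>_. 0"])
    show "\<forall>\<^sub>F j in sequentially. tnorm (tau \<alpha> (lat_scale (int p ^ m j) b))
       \<le> (\<Sum>d\<in>UNIV. \<bar>real_of_int (b $ d)\<bar> * (1 / real (Suc j)))"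
    proof (intro always_eventually allI)
      fix j
      have "tnorm (tmult (int p ^ m j) (\<alpha> d)) \<le> 1 / real (Suc j)" for d
        using m[of j] unfolding near_at_def by (simp add: less_imp_le)
      then have "tnorm (tmult (b $ d) (tmult (int p ^ m j) (\<alpha> d))) \<le> \<bar>real_of_int (b $ d)\<bar> * (1 / real (Suc j))" for d
        by (rule order_trans[OF tnorm_tmult_le mult_left_mono]) simp
      then show "tnorm (tau \<alpha> (lat_scale (int p ^ m j) b)) \<le> (\<Sum>d\<in>UNIV. \<bar>real_of_int (b $ d)\<bar> * (1 / real (Suc j)))"
        unfolding tau_lat_scale by (intro order_trans[OF tnorm_sum_le] sum_mono)
    qed
    have "(\<lambda>j. 1 / real (Suc j)) \<longlonglongrightarrow> 0" using LIMSEQ_inverse_real_of_nat by (simp add: inverse_eq_divide)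
    then show "(\<lambda>j. \<Sum>d\<in>UNIV. \<bar>real_of_int (b $ d)\<bar> * (1 / real (Suc j))) \<longlonglongrightarrow> 0"
      by (intro tendsto_null_sum tendsto_mult_right_zero)
  qed auto
  then show ?thesis by (rule that)
qed

section \<open>Iterates of a linear cellular automaton\<close>

lemma dvd_diff_trans:
  fixes a b c q :: "'a::comm_ring_1"
  assumes "q dvd a - b" "q dvd b - c" shows "q dvd a - c"
  using dvd_add[OF assms] by simp

lemma dvd_diff_sym:
  fixes a b q :: "'a::comm_ring_1"
  assumes "q dvd a - b" shows "q dvd b - a"
  using assms by (metis dvd_minus_iff minus_diff_eq)

lemma dvd_power_diff:
  fixes a b q :: "'a::comm_ring_1"
  assumes "q dvd a - b" shows "q dvd a ^ n - b ^ n"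
proof (induction n)
  case (Suc n)
  have "a ^ Suc n - b ^ Suc n = a * (a ^ n - b ^ n) + b ^ n * (a - b)" by (simp add: algebra_simps)
  then show ?case using Suc assms by (metis dvd_add dvd_mult)
qed simp

text \<open>
  The Frobenius identity is stated with divisibility by \<open>p\<close> in a ring of arbitrary characteristic,
  since the group ring that it is applied to has integer coefficients.
\<close>

lemma prime_dvd_binomial_power:
  fixes x y :: "'a::comm_ring_1"
  assumes p: "prime p"
  shows "of_nat p dvd (x + y) ^ p - (x ^ p + y ^ p)"
proof -
  have p0: "p > 0" using p by (rule prime_gt_0_nat)
  have "(x + y) ^ p = (\<Sum>k\<le>p. of_nat (p choose k) * x ^ k * y ^ (p - k))" by (rule binomial_ring)
  also have "{..p} = insert 0 (insert p {0<..<p})" using p0 by auto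
  also have "(\<Sum>k\<in>\<dots>. of_nat (p choose k) * x ^ k * y ^ (p - k))
      = y ^ p + (x ^ p + (\<Sum>k\<in>{0<..<p}. of_nat (p choose k) * x ^ k * y ^ (p - k)))"
    using p0 by (subst sum.insert, simp, simp, subst sum.insert) auto
  finally have eq: "(x + y) ^ p - (x ^ p + y ^ p) = (\<Sum>k\<in>{0<..<p}. of_nat (p choose k) * x ^ k * y ^ (p - k))"
    by simp
  have "of_nat p dvd (of_nat (p choose k) * x ^ k * y ^ (p - k) :: 'a)" if "k \<in> {0<..<p}" for k
  proof -
    have "p dvd p choose k" using that p by (intro dvd_choose_prime) auto
    then have "of_nat p dvd (of_nat (p choose k) :: 'a)" by (auto elim!: dvdE)
    then show ?thesis by (simp add: mult.assoc)
  qed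
  then show ?thesis unfolding eq by (rule dvd_sum)
qed

lemma prime_dvd_sum_power:
  fixes x :: "'b \<Rightarrow> 'a::comm_ring_1"
  assumes p: "prime p"
  shows "of_nat p dvd (\<Sum>i\<in>I. x i) ^ p - (\<Sum>i\<in>I. x i ^ p)"
proof (induction I rule: infinite_finite_induct)
  case (insert i I)
  have "(\<Sum>i\<in>insert i I. x i) ^ p - (\<Sum>i\<in>insert i I. x i ^ p)
     = ((x i + (\<Sum>i\<in>I. x i)) ^ p - (x i ^ p + (\<Sum>i\<in>I. x i) ^ p)) + ((\<Sum>i\<in>I. x i) ^ p - (\<Sum>i\<in>I. x i ^ p))"
    using insert.hyps by simp
  then show ?case using insert.IH prime_dvd_binomial_power[OF p] by (metis dvd_add)
qed (use prime_gt_0_nat[OF p] in \<open>auto simp: zero_power\<close>)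

lemma prime_dvd_sum_power_iterate:
  fixes x :: "'b \<Rightarrow> 'a::comm_ring_1"
  assumes p: "prime p"
  shows "of_nat p dvd (\<Sum>i\<in>I. x i) ^ (p ^ m) - (\<Sum>i\<in>I. x i ^ (p ^ m))"
proof (induction m)
  case (Suc m)
  have "of_nat p dvd ((\<Sum>i\<in>I. x i) ^ (p ^ m)) ^ p - (\<Sum>i\<in>I. x i ^ (p ^ m)) ^ p"
    by (rule dvd_power_diff[OF Suc])
  moreover have "of_nat p dvd (\<Sum>i\<in>I. x i ^ (p ^ m)) ^ p - (\<Sum>i\<in>I. (x i ^ (p ^ m)) ^ p)"
    by (rule prime_dvd_sum_power[OF p])
  ultimately have "of_nat p dvd ((\<Sum>i\<in>I. x i) ^ (p ^ m)) ^ p - (\<Sum>i\<in>I. (x i ^ (p ^ m)) ^ p)"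
    by (rule dvd_diff_trans)
  then show ?case by (simp flip: power_mult add: mult.commute)
qed simp

text \<open>
  Fermat's little theorem, from the Frobenius identity for a sum of ones.
\<close>

lemma prime_dvd_power_minus_self:
  fixes c :: int
  assumes p: "prime p"
  shows "int p dvd c ^ (p ^ m) - c"
proof -
  have n: "int p dvd int n ^ (p ^ m) - int n" for n
    using prime_dvd_sum_power_iterate[OF p, of "\<lambda>_. 1 :: int" "{..<n}" m] by simp
  have p0: "int p > 0" using prime_gt_0_nat[OF p] by simp
  define n where "n = nat (c mod int p)"
  have c: "int p dvd c - int n" using p0 by (simp add: n_def minus_mod_eq_mult_div)
  have "int p dvd c ^ (p ^ m) - int n ^ (p ^ m)" by (rule dvd_power_diff[OF c])
  then show ?thesis by (rule dvd_diff_trans[OF dvd_diff_trans[OF _ n] dvd_diff_sym[OF c]])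
qed

lemma poly_mapping_sum_single: "F = (\<Sum>b\<in>Poly_Mapping.keys F. Poly_Mapping.single b (Poly_Mapping.lookup F b))"
proof (rule poly_mapping_eqI)
  fix k
  have "(\<Sum>b\<in>Poly_Mapping.keys F. Poly_Mapping.lookup F b when b = k)
     = (\<Sum>b\<in>Poly_Mapping.keys F. if b = k then Poly_Mapping.lookup F k else 0)"
    by (rule sum.cong) (auto simp: when_def)
  then show "Poly_Mapping.lookup F k
     = Poly_Mapping.lookup (\<Sum>b\<in>Poly_Mapping.keys F. Poly_Mapping.single b (Poly_Mapping.lookup F b)) k"
    by (simp add: lookup_sum lookup_single in_keys_iff)
qed

text \<open>
  The group ring of \<open>\<int>\<^sup>D\<close>, with coefficients in \<open>\<int>\<close>: the keys of a polynomial mapping are the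
  exponents, and its product is the convolution.
\<close>

type_synonym 'd group_ring = "(int^'d) \<Rightarrow>\<^sub>0 int"

text \<open>
  The action on integer configurations for which the product of the ring is composition.
\<close>

definition act :: "'d::finite group_ring \<Rightarrow> (int^'d \<Rightarrow> int) \<Rightarrow> int^'d \<Rightarrow> int" where
  "act F C l = (\<Sum>b\<in>Poly_Mapping.keys F. Poly_Mapping.lookup F b * C (l + b))"

lemma act_superset:
  assumes "finite S" "Poly_Mapping.keys F \<subseteq> S"
  shows "act F C l = (\<Sum>b\<in>S. Poly_Mapping.lookup F b * C (l + b))"
  unfolding act_def using assms by (intro sum.mono_neutral_left) (auto simp: in_keys_iff)

lemma act_0 [simp]: "act 0 C l = 0" by (simp add: act_def)

lemma act_add: "act (F + G) C l = act F C l + act G C l"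
proof -
  let ?S = "Poly_Mapping.keys F \<union> Poly_Mapping.keys G"
  have "Poly_Mapping.keys (F + G) \<subseteq> ?S" by (rule Poly_Mapping.keys_add)
  then show ?thesis
    by (subst (1 2 3) act_superset[of ?S]) (auto simp: lookup_add distrib_right sum.distrib)
qed

lemma act_sum: "act (sum f I) C l = (\<Sum>i\<in>I. act (f i) C l)"
  by (induction I rule: infinite_finite_induct) (auto simp: act_add)

lemma act_single: "act (Poly_Mapping.single b c) C l = c * C (l + b)"
  by (simp add: act_def)

lemma act_mult: "act (F * G) C l = act F (act G C) l"
proof -
  have "F * G = (\<Sum>b\<in>Poly_Mapping.keys F. \<Sum>b'\<in>Poly_Mapping.keys G.
     Poly_Mapping.single (b + b') (Poly_Mapping.lookup F b * Poly_Mapping.lookup G b'))"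
    by (subst (1) poly_mapping_sum_single[of F], subst (1) poly_mapping_sum_single[of G])
       (simp add: sum_product mult_single)
  then show ?thesis
    by (simp add: act_sum act_single)
       (simp add: act_def sum_distrib_left mult.assoc add.assoc)
qed

lemma act_1 [simp]: "act 1 C l = C l"
  using act_single[of 0 1 C l] by (simp add: single_one)

lemma act_of_nat: "act (of_nat n) C l = int n * C l"
  using act_single[of 0 "of_nat n" C l] by (simp add: single_of_nat)

lemma act_cong_left:
  assumes "of_nat p dvd F - G" shows "int p dvd act F C l - act G C l"
proof -
  obtain H where "F = G + of_nat p * H" using assms by (auto elim!: dvdE simp: algebra_simps)
  then show ?thesis by (simp add: act_add act_mult act_of_nat)
qed

lemma act_cong_right:
  assumes "\<And>l. int p dvd C l - C' l" shows "int p dvd act F C l - act F C' l"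
  unfolding act_def sum_subtractf[symmetric] right_diff_distrib[symmetric]
  using assms by (intro dvd_sum dvd_mult)

lemma single_power:
  "Poly_Mapping.single (b :: int^'d) (c :: int) ^ n = Poly_Mapping.single (lat_scale (int n) b) (c ^ n)"
proof (induction n)
  case 0
  have "lat_scale 0 b = 0" by (simp add: lat_scale_def vec_eq_iff)
  then show ?case by (simp add: single_one)
next
  case (Suc n)
  have "b + lat_scale (int n) b = lat_scale (1 + int n) b"
    by (simp add: lat_scale_def vec_eq_iff algebra_simps)
  then show ?case by (simp add: Suc mult_single)
qed

definition ca_poly :: "(int^'d) set \<Rightarrow> (int^'d \<Rightarrow> nat) \<Rightarrow> 'd::finite group_ring" where
  "ca_poly B \<phi> = (\<Sum>b\<in>B. Poly_Mapping.single b (int (\<phi> b)))"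

lemma act_ca_poly: "act (ca_poly B \<phi>) C l = (\<Sum>b\<in>B. int (\<phi> b) * C (l + b))"
  by (simp add: ca_poly_def act_sum act_single)

lemma int_mod_dvd: "int p dvd x - x mod int p"
  by (simp add: minus_mod_eq_mult_div)

lemma ca_map_iterate_act:
  "int p dvd int ((ca_map p B \<phi> ^^ n) a l) - act (ca_poly B \<phi> ^ n) (\<lambda>l. int (a l)) l"
proof (induction n arbitrary: l)
  case (Suc n)
  let ?F = "ca_poly B \<phi>" and ?a = "(ca_map p B \<phi> ^^ n) a"
  have 1: "int p dvd act ?F (\<lambda>l. int (?a l)) l - act ?F (act (?F ^ n) (\<lambda>l. int (a l))) l"
    by (rule act_cong_right[OF Suc])
  have "int (ca_map p B \<phi> ?a l) = act ?F (\<lambda>l. int (?a l)) l mod int p"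
    by (simp add: ca_map_def local_map_def act_ca_poly of_nat_mod)
  then have 2: "int p dvd act ?F (\<lambda>l. int (?a l)) l - int (ca_map p B \<phi> ?a l)"
    by (simp add: int_mod_dvd)
  show ?case using dvd_diff_trans[OF dvd_diff_sym[OF 2] 1] by (simp add: act_mult)
qed simp

lemma act_ca_poly_const: "act (ca_poly B \<phi> ^ n) (\<lambda>_. c) l = int (\<Sum>b\<in>B. \<phi> b) ^ n * c"
proof (induction n arbitrary: l)
  case (Suc n)
  have "act (ca_poly B \<phi> ^ n) (\<lambda>_. c) = (\<lambda>_. int (\<Sum>b\<in>B. \<phi> b) ^ n * c)" using Suc by blast
  then show ?case by (simp add: act_mult act_ca_poly sum_distrib_right mult.assoc)
qed simp

text \<open>
  The Frobenius identity replaces the power \<open>p\<^sup>m\<close> of \<open>G = F\<^sup>r\<close> by the sum \<open>S\<close> of the powers of the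
  monomials of \<open>G\<close>. Their exponents are the ones of \<open>G\<close>, dilated, and their coefficients are
  those of \<open>G\<close> modulo \<open>p\<close>, by Fermat. On a configuration that is constant on the dilated
  neighbourhood, \<open>S\<close> thus acts like \<open>G\<close> on a constant configuration, through the sum of
  its coefficients, which is the power \<open>r\<close> of the trace.
\<close>

lemma ca_map_prime_power_iterate:
  assumes p: "prime p"
    and const: "\<And>b. b \<in> Poly_Mapping.keys (ca_poly B \<phi> ^ r) \<Longrightarrow> a (l + lat_scale (int p ^ m) b) = a l"
  shows "(ca_map p B \<phi> ^^ (r * p ^ m)) a l mod p = ((\<Sum>b\<in>B. \<phi> b) ^ r * a l) mod p"
proof -
  let ?G = "ca_poly B \<phi> ^ r" and ?C = "\<lambda>l. int (a l)" and ?T = "\<Sum>b\<in>B. \<phi> b"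
  let ?g = "Poly_Mapping.lookup ?G" and ?K = "Poly_Mapping.keys ?G"
  define S where "S = (\<Sum>b\<in>?K. Poly_Mapping.single b (?g b) ^ (p ^ m))"
  have "of_nat p dvd ?G ^ (p ^ m) - S"
    unfolding S_def by (subst (1) poly_mapping_sum_single[of ?G]) (rule prime_dvd_sum_power_iterate[OF p])
  then have 1: "int p dvd act (?G ^ (p ^ m)) ?C l - act S ?C l" by (rule act_cong_left)
  have "act S ?C l = (\<Sum>b\<in>?K. ?g b ^ (p ^ m) * int (a l))"
    by (auto simp: S_def act_sum act_single single_power const intro!: sum.cong)
  moreover have "act ?G (\<lambda>_. int (a l)) l = (\<Sum>b\<in>?K. ?g b * int (a l))" by (simp add: act_def)
  ultimately have "act S ?C l - act ?G (\<lambda>_. int (a l)) l = (\<Sum>b\<in>?K. (?g b ^ (p ^ m) - ?g b) * int (a l))"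
    by (simp add: sum_subtractf left_diff_distrib)
  then have 2: "int p dvd act S ?C l - act ?G (\<lambda>_. int (a l)) l"
    by (auto intro!: dvd_sum dvd_mult2 prime_dvd_power_minus_self[OF p])
  have 3: "int p dvd int ((ca_map p B \<phi> ^^ (r * p ^ m)) a l) - act (?G ^ (p ^ m)) ?C l"
    using ca_map_iterate_act[of p "r * p ^ m" B \<phi> a l] by (simp add: power_mult)
  have "int p dvd int ((ca_map p B \<phi> ^^ (r * p ^ m)) a l) - act ?G (\<lambda>_. int (a l)) l"
    by (rule dvd_diff_trans[OF 3 dvd_diff_trans[OF 1 2]])
  then have "int p dvd int ((ca_map p B \<phi> ^^ (r * p ^ m)) a l) - int (?T ^ r * a l)"
    by (simp add: act_ca_poly_const)
  then have "int ((ca_map p B \<phi> ^^ (r * p ^ m)) a l) mod int p = int (?T ^ r * a l) mod int p"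
    by (simp only: mod_eq_dvd_iff)
  then show ?thesis by (metis of_nat_mod of_nat_eq_iff)
qed

lemma ca_map_less: "p > 0 \<Longrightarrow> ca_map p B \<phi> a l < p"
  by (simp add: ca_map_def local_map_def)

lemma ca_map_iterate_less:
  assumes "p > 0" "n > 0 \<or> (\<forall>l. a l < p)"
  shows "(ca_map p B \<phi> ^^ n) a l < p"
  using assms by (cases n) (auto simp: ca_map_less)

lemma ca_map_niltropic:
  assumes p: "prime p" and T: "ca_trace p B \<phi> = 0"
    and const: "\<And>b. b \<in> Poly_Mapping.keys (ca_poly B \<phi>) \<Longrightarrow> a (l + lat_scale (int p ^ m) b) = a l"
  shows "(ca_map p B \<phi> ^^ (p ^ m)) a l = 0"
proof -
  have p0: "p > 0" using p by (rule prime_gt_0_nat)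
  have "p dvd (\<Sum>b\<in>B. \<phi> b)" using T by (simp add: ca_trace_def dvd_eq_mod_eq_0)
  then have "p dvd (\<Sum>b\<in>B. \<phi> b) * a l" by simp
  then have "(ca_map p B \<phi> ^^ (p ^ m)) a l mod p = 0"
    using ca_map_prime_power_iterate[OF p, of B \<phi> 1 a l m] const by (simp add: dvd_eq_mod_eq_0)
  moreover have "(ca_map p B \<phi> ^^ (p ^ m)) a l < p"
    using p0 by (intro ca_map_iterate_less) auto
  ultimately show ?thesis by simp
qed

lemma ca_map_rigid:
  assumes p: "prime p" and T: "ca_trace p B \<phi> \<noteq> 0"
    and const: "\<And>b. b \<in> Poly_Mapping.keys (ca_poly B \<phi> ^ (p - 1)) \<Longrightarrow> a (l + lat_scale (int p ^ m) b) = a l"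
    and a: "\<And>l. a l < p"
  shows "(ca_map p B \<phi> ^^ ((p - 1) * p ^ m)) a l = a l"
proof -
  let ?T = "\<Sum>b\<in>B. \<phi> b"
  have p0: "p > 0" using p by (rule prime_gt_0_nat)
  have "\<not> p dvd ?T" using T by (simp add: ca_trace_def dvd_eq_mod_eq_0)
  then have nT: "\<not> int p dvd int ?T" by (metis int_dvd_int_iff)
  have "int p dvd int ?T ^ p - int ?T" using prime_dvd_power_minus_self[OF p, of "int ?T" 1] by simp
  also have "int ?T ^ p - int ?T = int ?T * (int ?T ^ (p - 1) - 1)"
    using p0 by (cases p) (simp_all add: algebra_simps)
  finally have "int p dvd int ?T ^ (p - 1) - 1"
    using nT p by (metis prime_dvd_multD prime_nat_int_transfer)
  then have "int p dvd (int ?T ^ (p - 1) - 1) * int (a l)" by (rule dvd_mult2)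
  then have "int p dvd int (?T ^ (p - 1) * a l) - int (a l)" by (simp add: left_diff_distrib)
  then have "int (?T ^ (p - 1) * a l) mod int p = int (a l) mod int p" by (simp only: mod_eq_dvd_iff)
  then have "(?T ^ (p - 1) * a l) mod p = a l mod p" by (metis of_nat_mod of_nat_eq_iff)
  then have "(ca_map p B \<phi> ^^ ((p - 1) * p ^ m)) a l mod p = a l mod p"
    using ca_map_prime_power_iterate[OF p, of B \<phi> "p - 1" a l m] const by simp
  moreover have "(ca_map p B \<phi> ^^ ((p - 1) * p ^ m)) a l < p"
    using p0 a by (intro ca_map_iterate_less) auto
  ultimately show ?thesis using a[of l] by simp
qed

section \<open>Continuity of translation in measure\<close>

definition erode :: "real \<Rightarrow> (circle^'k) set \<Rightarrow> (circle^'k) set" where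
  "erode e A = {s. \<forall>t. tnorm (t - s) < e \<longrightarrow> t \<in> A}"

lemma erode_subset: "e > 0 \<Longrightarrow> erode e A \<subseteq> A"
  by (auto simp: erode_def)

lemma erode_antimono: "d \<le> e \<Longrightarrow> erode e A \<subseteq> erode d A"
  by (auto simp: erode_def)

lemma closed_erode: "closed (erode e A)"
proof -
  have "- erode e A = (\<Union>t\<in>- A. {s. tnorm (s - t) < e})"
    by (auto simp: erode_def tnorm_minus_commute)
  then show ?thesis
    unfolding closed_def by (auto intro!: open_UN open_tnorm_ball)
qed

lemma erode_borel [measurable]: "erode e A \<in> sets borel"
  by (rule borel_closed[OF closed_erode])

lemma erode_ball:
  assumes "tnorm (t - s) < d" "t \<in> erode (d + e) A" shows "s \<in> erode e A"
  unfolding erode_def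
proof (intro CollectI allI impI)
  fix u assume "tnorm (u - s) < e"
  moreover have "tnorm (s - t) < d" using assms(1) by (simp add: tnorm_minus_commute)
  ultimately have "tnorm (u - t) < e + d" by (rule tnorm_triangle_less)
  then show "u \<in> A" using assms(2) by (simp add: erode_def add.commute)
qed

lemma open_erode_exhausts:
  fixes A :: "(circle^'k) set"
  assumes "open A" shows "(\<Union>n. erode (1 / real (Suc n)) A) = A"
proof
  show "(\<Union>n. erode (1 / real (Suc n)) A) \<subseteq> A" by (intro UN_least erode_subset) simp
  show "A \<subseteq> (\<Union>n. erode (1 / real (Suc n)) A)"
  proof
    fix s assume "s \<in> A"
    then obtain e where e: "e > 0" "\<And>t. tnorm (t - s) < e \<Longrightarrow> t \<in> A"
      using open_torus_ball[OF assms] by blast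
    obtain n where "1 / real (Suc n) < e" using e(1) by (metis nat_approx_posE)
    then have "s \<in> erode (1 / real (Suc n)) A" using e(2) by (auto simp: erode_def)
    then show "s \<in> (\<Union>n. erode (1 / real (Suc n)) A)" by blast
  qed
qed

lemma measure_minus_erode:
  fixes A :: "(circle^'k) set"
  assumes A: "open A"
  shows "(\<lambda>n. measure haar (A - erode (1 / real (Suc n)) A)) \<longlonglongrightarrow> 0"
proof -
  have "decseq (\<lambda>n. A - erode (1 / real (Suc n)) A)"
    unfolding decseq_def by (intro allI impI Diff_mono order_refl erode_antimono) (simp add: frac_le)
  then have "(\<lambda>n. measure haar (A - erode (1 / real (Suc n)) A))
      \<longlonglongrightarrow> measure haar (\<Inter>n. A - erode (1 / real (Suc n)) A)"
    using A by (intro haar.finite_Lim_measure_decseq) auto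
  also have "(\<Inter>n. A - erode (1 / real (Suc n)) A) = {}"
    using open_erode_exhausts[OF A] by blast
  finally show ?thesis by simp
qed

abbreviation translate :: "circle^'k \<Rightarrow> (circle^'k) set \<Rightarrow> (circle^'k) set" where
  "translate h A \<equiv> (\<lambda>s. s + h) -` A"

lemma translate_borel: "A \<in> sets borel \<Longrightarrow> translate h A \<in> sets borel"
  using measurable_sets[OF torus_add_measurable, of A] by simp

lemma measure_haar_translate: "A \<in> sets borel \<Longrightarrow> measure haar (translate h A) = measure haar A"
  by (simp add: measure_def emeasure_haar_translate)

text \<open>
  The one-sided difference suffices: by translation invariance, the two halves of the symmetric
  difference have the same measure.
\<close>

definition translation_continuous :: "(circle^'k) set \<Rightarrow> bool" where
  "translation_continuous A \<longleftrightarrow>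
    (\<forall>e>0. \<exists>d>0. \<forall>h. tnorm h < d \<longrightarrow> measure haar (A - translate h A) < e)"

text \<open>
  A translation by less than the radius keeps every point of the eroded set inside \<open>A\<close>.
\<close>

lemma translation_continuous_open:
  assumes "open A" shows "translation_continuous A"
  unfolding translation_continuous_def
proof (intro allI impI)
  fix e :: real assume e: "e > 0"
  have "\<forall>\<^sub>F n in sequentially. measure haar (A - erode (1 / real (Suc n)) A) < e"
    by (rule order_tendstoD(2)[OF measure_minus_erode[OF assms] e])
  then obtain n where n: "measure haar (A - erode (1 / real (Suc n)) A) < e"
    by (auto simp: eventually_sequentially)
  have "measure haar (A - translate h A) < e" if "tnorm h < 1 / real (Suc n)" for h
  proof (rule order_le_less_trans[OF _ n], rule haar.finite_measure_mono)
    show "A - translate h A \<subseteq> A - erode (1 / real (Suc n)) A"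
      using that by (auto simp: erode_def)
    show "A - erode (1 / real (Suc n)) A \<in> sets haar" using assms by auto
  qed
  then show "\<exists>d>0. \<forall>h. tnorm h < d \<longrightarrow> measure haar (A - translate h A) < e"
    by (intro exI[of _ "1 / real (Suc n)"]) auto
qed

lemma translation_continuous_Compl:
  assumes [measurable]: "A \<in> sets borel" and A: "translation_continuous A"
  shows "translation_continuous (UNIV - A)"
proof -
  have "measure haar ((UNIV - A) - translate h (UNIV - A)) = measure haar (A - translate h A)" for h
  proof -
    note [measurable] = translate_borel[OF assms(1), of h]
    have "(UNIV - A) - translate h (UNIV - A) = translate h A - translate h A \<inter> A" by auto
    also have "measure haar \<dots> = measure haar (translate h A) - measure haar (translate h A \<inter> A)"
      by (intro haar.finite_measure_Diff) auto
    also have "\<dots> = measure haar A - measure haar (translate h A \<inter> A)"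
      by (simp add: measure_haar_translate)
    also have "\<dots> = measure haar (A - translate h A \<inter> A)"
      by (intro haar.finite_measure_Diff[symmetric]) auto
    also have "A - translate h A \<inter> A = A - translate h A" by auto
    finally show ?thesis .
  qed
  then show ?thesis using A by (simp add: translation_continuous_def)
qed

text \<open>
  In a finite measure space, finitely many of the sets exhaust the union up to measure \<open>e / 2\<close>, and
  the error of a finite union is at most the sum of the errors.
\<close>

lemma translation_continuous_UN:
  fixes A :: "nat \<Rightarrow> (circle^'k) set"
  assumes m [measurable]: "\<And>i. A i \<in> sets borel" and A: "\<And>i. translation_continuous (A i)"
  shows "translation_continuous (\<Union>i. A i)"
  unfolding translation_continuous_def
proof (intro allI impI)
  fix e :: real assume e: "e > 0"
  let ?U = "\<Union>i. A i" and ?B = "\<lambda>n. \<Union>i<n. A i"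
  have "decseq (\<lambda>n. ?U - ?B n)" unfolding decseq_def by (auto intro: order_less_le_trans)
  then have "(\<lambda>n. measure haar (?U - ?B n)) \<longlonglongrightarrow> measure haar (\<Inter>n. ?U - ?B n)"
    by (intro haar.finite_Lim_measure_decseq) auto
  also have "(\<Inter>n. ?U - ?B n) = {}" by auto
  finally have "(\<lambda>n. measure haar (?U - ?B n)) \<longlonglongrightarrow> 0" by simp
  then have "\<forall>\<^sub>F n in sequentially. measure haar (?U - ?B n) < e / 2"
    using e by (intro order_tendstoD(2)) auto
  then obtain n where n: "measure haar (?U - ?B n) < e / 2" by (auto simp: eventually_sequentially)
  \<comment> \<open>The budget for each of the \<open>n\<close> sets; the successor covers the case \<open>n = 0\<close>.\<close>
  define c where "c = e / (2 * real (Suc n))"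
  have c: "c > 0" using e by (simp add: c_def)
  have "\<forall>i. \<exists>d>0. \<forall>h. tnorm h < d \<longrightarrow> measure haar (A i - translate h (A i)) < c"
    using A c unfolding translation_continuous_def by blast
  then obtain d where d: "\<And>i. d i > 0" "\<And>i h. tnorm h < d i \<Longrightarrow> measure haar (A i - translate h (A i)) < c"
    by metis
  define d0 where "d0 = Min (insert 1 (d ` {..<n}))"
  have d0: "d0 > 0" using d(1) by (auto simp: d0_def)
  have d0_le: "d0 \<le> d i" if "i < n" for i using that by (auto simp: d0_def)
  have "measure haar (?U - translate h ?U) < e" if h: "tnorm h < d0" for h
  proof -
    note [measurable] = translate_borel[OF m, of h]
    have "measure haar (?U - translate h ?U)
       \<le> measure haar ((?U - ?B n) \<union> (\<Union>i<n. A i - translate h (A i)))"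
      by (intro haar.finite_measure_mono) auto
    also have "\<dots> \<le> measure haar (?U - ?B n) + measure haar (\<Union>i<n. A i - translate h (A i))"
      by (intro measure_Un_le) auto
    also have "measure haar (\<Union>i<n. A i - translate h (A i)) \<le> (\<Sum>i<n. measure haar (A i - translate h (A i)))"
      by (intro measure_UNION_le) auto
    also have "\<dots> \<le> (\<Sum>i<n. c)"
    proof (intro sum_mono less_imp_le d(2))
      fix i assume "i \<in> {..<n}"
      then show "tnorm h < d i" using h d0_le[of i] by simp
    qed
    also have "\<dots> \<le> e / 2" using e by (simp add: c_def field_simps)
    finally show ?thesis using n by simp
  qed
  then show "\<exists>d>0. \<forall>h. tnorm h < d \<longrightarrow> measure haar (?U - translate h ?U) < e"
    using d0 by blast
qed

lemma translation_continuous_borel: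
  assumes "A \<in> sets borel" shows "translation_continuous A"
proof -
  have "A \<in> sigma_sets UNIV {S. open S}" using assms by (simp add: borel_def)
  then show ?thesis
  proof induction
    case (Basic a) then show ?case by (simp add: translation_continuous_open)
  next
    case Empty show ?case by (rule translation_continuous_open) simp
  next
    case (Compl a)
    then have "a \<in> sets borel" by (simp add: borel_def)
    then show ?case by (rule translation_continuous_Compl) fact
  next
    case (Union a)
    then have "a i \<in> sets borel" for i by (simp add: borel_def)
    then show ?case using Union.IH by (rule translation_continuous_UN)
  qed
qed

lemma measure_leb_translation_continuous:
  fixes A :: "(circle^'k) set"
  assumes A: "A \<in> sets leb" and h: "(\<lambda>j. tnorm (h j)) \<longlonglongrightarrow> 0"
  shows "(\<lambda>j. measure leb (A - translate (h j) A)) \<longlonglongrightarrow> 0"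
proof -
  obtain S N N' where SN: "A = S \<union> N" "N \<subseteq> N'" "N' \<in> null_sets haar" "S \<in> sets haar"
    using A unfolding leb_def by (rule sets_completionE)
  have S: "S \<in> sets borel" using SN(4) by simp
  have N': "N' \<in> sets borel" "measure haar N' = 0"
    using SN(3) by (auto simp: null_sets_def measure_def)
  have le: "measure leb (A - translate k A) \<le> measure haar (S - translate k S)" for k
  proof -
    have "measure leb (A - translate k A) \<le> measure leb ((S - translate k S) \<union> N')"
      using SN S N' translate_borel[OF S, of k]
      by (intro leb.finite_measure_mono sets_leb_borel sets.Un sets.Diff) auto
    also have "\<dots> = measure haar ((S - translate k S) \<union> N')"
      using S N' translate_borel[OF S, of k] by (intro measure_leb_borel sets.Un sets.Diff)
    also have "\<dots> \<le> measure haar (S - translate k S) + measure haar N'"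
      using S N' translate_borel[OF S, of k] by (intro measure_Un_le) auto
    finally show ?thesis using N' by simp
  qed
  show ?thesis
  proof (rule LIMSEQ_I)
    fix e :: real assume e: "e > 0"
    obtain d where d: "d > 0" "\<And>h. tnorm h < d \<Longrightarrow> measure haar (S - translate h S) < e"
      using translation_continuous_borel[OF S] e unfolding translation_continuous_def by blast
    have "\<forall>\<^sub>F j in sequentially. tnorm (h j) < d" by (rule order_tendstoD(2)[OF h d(1)])
    then obtain n0 where "\<And>j. j \<ge> n0 \<Longrightarrow> tnorm (h j) < d" by (auto simp: eventually_sequentially)
    then have "\<And>j. j \<ge> n0 \<Longrightarrow> measure leb (A - translate (h j) A) < e"
      using d(2) le by (meson order_le_less_trans)
    then show "\<exists>no. \<forall>n\<ge>no. norm (measure leb (A - translate (h n) A) - 0) < e"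
      by auto
  qed
qed

section \<open>Configurations read along orbits\<close>

lemma mem_shift_image: "s \<in> shift \<alpha> l ` X \<longleftrightarrow> s + tau \<alpha> (- l) \<in> X"
proof
  assume "s \<in> shift \<alpha> l ` X" then show "s + tau \<alpha> (- l) \<in> X"
    by (auto simp: shift_def tau_minus)
next
  assume "s + tau \<alpha> (- l) \<in> X" then show "s \<in> shift \<alpha> l ` X"
    by (intro image_eqI[of _ _ "s + tau \<alpha> (- l)"]) (auto simp: shift_def tau_minus)
qed

lemma good_points_iff: "s \<in> good_points p \<alpha> P \<longleftrightarrow> (\<forall>l. s + tau \<alpha> l \<in> part_union p P)"
  unfolding good_points_def mem_shift_image[abs_def] INT_iff
  by (metis UNIV_I mem_shift_image minus_minus)

lemma config_of_properties:
  assumes P: "disjoint_family_on P {..<p}" and s: "s \<in> good_points p \<alpha> P"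
  shows config_of_less: "config_of p \<alpha> P s l < p"
    and config_of_mem: "s + tau \<alpha> l \<in> P (config_of p \<alpha> P s l)"
    and config_of_eq: "a < p \<Longrightarrow> s + tau \<alpha> l \<in> P a \<Longrightarrow> config_of p \<alpha> P s l = a"
proof -
  obtain a0 where a0: "a0 < p" "s + tau \<alpha> l \<in> P a0"
    using s by (auto simp: good_points_iff part_union_def)
  have uniq: "a = a0" if "a < p" "s + tau \<alpha> l \<in> P a" for a
    using P that a0 unfolding disjoint_family_on_def by blast
  have eq: "config_of p \<alpha> P s l = a0"
    unfolding config_of_def shift_def by (intro the_equality conjI a0) (use uniq in blast)
  show "config_of p \<alpha> P s l < p" "s + tau \<alpha> l \<in> P (config_of p \<alpha> P s l)"
    using a0 eq by auto
  show "config_of p \<alpha> P s l = a" if "a < p" "s + tau \<alpha> l \<in> P a"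
    using uniq[OF that] eq by simp
qed

lemma ca_part_iff:
  "s \<in> ca_part p \<alpha> B \<phi> P a \<longleftrightarrow>
    (\<exists>c \<in> B \<rightarrow>\<^sub>E {..<p}. local_map p B \<phi> c = a \<and> (\<forall>b\<in>B. s + tau \<alpha> b \<in> P (c b)))"
proof -
  have "s \<in> shift \<alpha> (- b) ` X \<longleftrightarrow> s + tau \<alpha> b \<in> X" for b X
    by (simp add: mem_shift_image)
  then show ?thesis unfolding ca_part_def by auto
qed

text \<open>
  Reading labels along the orbit of a good point intertwines the map on partitions with the cellular
  automaton, so that everything about partitions can be computed with configurations.
\<close>

lemma ca_part_iterate_iff:
  assumes p: "p > 0" and P: "disjoint_family_on P {..<p}" and s: "s \<in> good_points p \<alpha> P"
    and a: "a < p"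
  shows "s + tau \<alpha> l \<in> (ca_part p \<alpha> B \<phi> ^^ n) P a \<longleftrightarrow> (ca_map p B \<phi> ^^ n) (config_of p \<alpha> P s) l = a"
  using a
proof (induction n arbitrary: l a)
  case 0
  then show ?case using config_of_mem[OF P s] config_of_eq[OF P s] by auto
next
  case (Suc n)
  let ?C = "(ca_map p B \<phi> ^^ n) (config_of p \<alpha> P s)"
  have C: "?C l < p" for l
    using p config_of_less[OF P s] by (intro ca_map_iterate_less) auto
  have IH: "s + tau \<alpha> l + tau \<alpha> b \<in> (ca_part p \<alpha> B \<phi> ^^ n) P c \<longleftrightarrow> ?C (l + b) = c" if "c < p" for b c
    using Suc.IH[OF that, of "l + b"] by (simp add: tau_add add.assoc)
  have lm: "local_map p B \<phi> c = local_map p B \<phi> c'" if "\<And>b. b \<in> B \<Longrightarrow> c b = c' b" for c c'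
    unfolding local_map_def using that by simp
  have "s + tau \<alpha> l \<in> (ca_part p \<alpha> B \<phi> ^^ Suc n) P a \<longleftrightarrow>
     (\<exists>c \<in> B \<rightarrow>\<^sub>E {..<p}. local_map p B \<phi> c = a \<and> (\<forall>b\<in>B. ?C (l + b) = c b))"
    unfolding funpow.simps comp_def ca_part_iff using IH by (intro bex_cong refl conj_cong ball_cong) auto
  also have "\<dots> \<longleftrightarrow> local_map p B \<phi> (\<lambda>b. ?C (l + b)) = a"
  proof
    assume "local_map p B \<phi> (\<lambda>b. ?C (l + b)) = a"
    then show "\<exists>c \<in> B \<rightarrow>\<^sub>E {..<p}. local_map p B \<phi> c = a \<and> (\<forall>b\<in>B. ?C (l + b) = c b)"
      using C lm[of "restrict (\<lambda>b. ?C (l + b)) B" "\<lambda>b. ?C (l + b)"]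
      by (intro bexI[of _ "restrict (\<lambda>b. ?C (l + b)) B"]) auto
  qed (use lm in metis)
  finally show ?case by (simp add: ca_map_def[of p B \<phi> ?C l])
qed

lemma good_points_null:
  assumes P: "P \<in> partitions p"
  shows "- good_points p \<alpha> P \<in> null_sets leb"
proof -
  have U: "part_union p P \<in> sets leb" "measure leb (part_union p P) = 1"
    using P by (auto simp: partitions_def part_union_def)
  then have "measure leb (- part_union p P) = 0"
    using leb.prob_compl[OF U(1)] by (simp add: Compl_eq_Diff_UNIV)
  then have "measure leb (translate (tau \<alpha> l) (- part_union p P)) = 0" for l
    using U leb_translate(2)[of "- part_union p P"] sets.compl_sets[of "part_union p P" leb]
    by (simp add: Compl_eq_Diff_UNIV)
  moreover have "translate (tau \<alpha> l) (- part_union p P) \<in> sets leb" for l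
    using U leb_translate(1)[of "- part_union p P"] sets.compl_sets[of "part_union p P" leb]
    by (simp add: Compl_eq_Diff_UNIV)
  ultimately have "translate (tau \<alpha> l) (- part_union p P) \<in> null_sets leb" for l
    by (auto simp: null_sets_def leb.emeasure_eq_measure)
  then have "(\<Union>l. translate (tau \<alpha> l) (- part_union p P)) \<in> null_sets leb"
    by (intro null_sets_UN') auto
  also have "(\<Union>l. translate (tau \<alpha> l) (- part_union p P)) = - good_points p \<alpha> P"
    by (auto simp: good_points_iff)
  finally show ?thesis .
qed

section \<open>Niltropy and rigidity for partitions\<close>

text \<open>
  The set \<open>X j\<close> collects the points that leave their own cell under one of the translations by \<open>\<tau> (v j b)\<close>,
  and the points whose orbit meets no cell at some time. Continuity of translation makes the former
  small, and the latter are null.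
\<close>

lemma orbit_changes_null:
  fixes \<alpha> :: "'d::finite \<Rightarrow> circle^'k"
  assumes P: "P \<in> partitions p" and fin: "finite K"
    and ret: "\<And>b. (\<lambda>j. tnorm (tau \<alpha> (v j b))) \<longlonglongrightarrow> 0"
  obtains X where "\<And>j. X j \<in> sets leb" "(\<lambda>j. measure leb (X j)) \<longlonglongrightarrow> 0"
    "\<And>j s. s \<notin> X j \<Longrightarrow> s \<in> good_points p \<alpha> P"
    "\<And>j s b. s \<notin> X j \<Longrightarrow> b \<in> K \<Longrightarrow> config_of p \<alpha> P s (v j b) = config_of p \<alpha> P s 0"
proof -
  define Y where "Y j b a = P a - translate (tau \<alpha> (v j b)) (P a)" for j b a
  define X where "X j = - good_points p \<alpha> P \<union> (\<Union>b\<in>K. \<Union>a<p. Y j b a)" for j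
  have disj: "disjoint_family_on P {..<p}" using P by (simp add: partitions_def)
  have Pm: "P a \<in> sets leb" if "a < p" for a using P that by (simp add: partitions_def)
  have Y: "Y j b a \<in> sets leb" if "a < p" for j b a
    unfolding Y_def using Pm[OF that] leb_translate(1) by blast
  have YU: "(\<Union>a<p. Y j b a) \<in> sets leb" for j b using Y by (intro sets.finite_UN) auto
  have YUU: "(\<Union>b\<in>K. \<Union>a<p. Y j b a) \<in> sets leb" for j by (rule sets.finite_UN[OF fin YU])
  have G: "- good_points p \<alpha> P \<in> sets leb" "measure leb (- good_points p \<alpha> P) = 0"
    using good_points_null[OF P, of \<alpha>] by (auto simp: null_sets_def measure_def)
  have X: "X j \<in> sets leb" for j unfolding X_def using G YUU by blast
  have le: "measure leb (X j) \<le> (\<Sum>b\<in>K. \<Sum>a<p. measure leb (Y j b a))" for j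
  proof -
    have "measure leb (X j) \<le> measure leb (- good_points p \<alpha> P) + measure leb (\<Union>b\<in>K. \<Union>a<p. Y j b a)"
      unfolding X_def by (rule measure_Un_le[OF G(1) YUU])
    also have "measure leb (\<Union>b\<in>K. \<Union>a<p. Y j b a) \<le> (\<Sum>b\<in>K. measure leb (\<Union>a<p. Y j b a))"
      by (rule measure_UNION_le[OF fin YU])
    also have "\<dots> \<le> (\<Sum>b\<in>K. \<Sum>a<p. measure leb (Y j b a))"
      using Y by (intro sum_mono measure_UNION_le) auto
    finally show ?thesis using G by simp
  qed
  have "(\<lambda>j. measure leb (X j)) \<longlonglongrightarrow> 0"
  proof (rule tendsto_sandwich[of "\<lambda>_. 0"])
    show "\<forall>\<^sub>F j in sequentially. measure leb (X j) \<le> (\<Sum>b\<in>K. \<Sum>a<p. measure leb (Y j b a))"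
      using le by simp
    show "(\<lambda>j. \<Sum>b\<in>K. \<Sum>a<p. measure leb (Y j b a)) \<longlonglongrightarrow> 0"
      unfolding Y_def using Pm ret
      by (intro tendsto_null_sum measure_leb_translation_continuous) auto
  qed auto
  moreover have "s \<in> good_points p \<alpha> P" if "s \<notin> X j" for s j using that by (simp add: X_def)
  moreover have "config_of p \<alpha> P s (v j b) = config_of p \<alpha> P s 0" if "s \<notin> X j" "b \<in> K" for s j b
  proof -
    have s: "s \<in> good_points p \<alpha> P" using that by (simp add: X_def)
    let ?a = "config_of p \<alpha> P s 0"
    have a: "?a < p" "s \<in> P ?a"
      using config_of_less[OF disj s] config_of_mem[OF disj s, of 0] by auto
    then have "s \<notin> Y j b ?a" using that by (auto simp: X_def)
    then have "s + tau \<alpha> (v j b) \<in> P ?a" using a(2) by (simp add: Y_def)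
    then show ?thesis by (rule config_of_eq[OF disj s a(1)])
  qed
  ultimately show ?thesis using X that by blast
qed

lemma d_tri_tendsto_0:
  assumes X: "\<And>j. X j \<in> sets leb" "(\<lambda>j. measure leb (X j)) \<longlonglongrightarrow> 0"
    and sub: "\<And>j a. a < p \<Longrightarrow> sym_diff (R j a) (Q a) \<subseteq> X j"
  shows "(\<lambda>j. d_tri p (R j) Q) \<longlonglongrightarrow> 0"
proof (rule tendsto_sandwich[of "\<lambda>_. 0"])
  have "d_tri p (R j) Q \<le> (\<Sum>a<p. measure leb (X j))" for j
    unfolding d_tri_def using sub X(1) by (intro sum_mono leb.finite_measure_mono) auto
  then show "\<forall>\<^sub>F j in sequentially. d_tri p (R j) Q \<le> (\<Sum>a<p. measure leb (X j))" by simp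
  show "(\<lambda>j. \<Sum>a<p. measure leb (X j)) \<longlonglongrightarrow> 0"
    by (intro tendsto_null_sum X(2))
qed (auto simp: d_tri_def intro!: always_eventually sum_nonneg)

lemma niltropic_M_return_times:
  fixes \<alpha> :: "'d::finite \<Rightarrow> circle^'k"
  assumes p: "prime p" and T: "ca_trace p B \<phi> = 0"
    and ret: "\<And>b. (\<lambda>j. tnorm (tau \<alpha> (lat_scale (int p ^ m j) b))) \<longlonglongrightarrow> 0"
  shows "niltropic_M p \<alpha> B \<phi> (\<lambda>j. p ^ m j)"
  unfolding niltropic_M_def
proof
  have p0: "p > 0" using p by (rule prime_gt_0_nat)
  fix Q :: "nat \<Rightarrow> (circle^'k) set" assume Q: "Q \<in> partitions p"
  then have disj: "disjoint_family_on Q {..<p}" by (simp add: partitions_def)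
  obtain X where X: "\<And>j. X j \<in> sets leb" "(\<lambda>j. measure leb (X j)) \<longlonglongrightarrow> 0"
    and G: "\<And>j s. s \<notin> X j \<Longrightarrow> s \<in> good_points p \<alpha> Q"
    and const: "\<And>j s b. s \<notin> X j \<Longrightarrow> b \<in> Poly_Mapping.keys (ca_poly B \<phi>) \<Longrightarrow>
         config_of p \<alpha> Q s (lat_scale (int p ^ m j) b) = config_of p \<alpha> Q s 0"
    by (rule orbit_changes_null[OF Q finite_keys[of "ca_poly B \<phi>"] ret]) (rule that)
  show "(\<lambda>k. d_tri p ((ca_part p \<alpha> B \<phi> ^^ p ^ m k) Q) zero_part) \<longlonglongrightarrow> 0"
  proof (rule d_tri_tendsto_0[OF X])
    fix j a assume a: "a < p"
    have "s \<in> (ca_part p \<alpha> B \<phi> ^^ p ^ m j) Q a \<longleftrightarrow> s \<in> zero_part a" if s: "s \<notin> X j" for s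
    proof -
      have "(ca_map p B \<phi> ^^ p ^ m j) (config_of p \<alpha> Q s) 0 = 0"
        using const[OF s] by (intro ca_map_niltropic[OF p T]) simp
      then show ?thesis
        using ca_part_iterate_iff[OF p0 disj G[OF s] a, of 0] by (auto simp: zero_part_def)
    qed
    then show "sym_diff ((ca_part p \<alpha> B \<phi> ^^ p ^ m j) Q a) (zero_part a) \<subseteq> X j" by blast
  qed
qed

lemma rigid_M_return_times:
  fixes \<alpha> :: "'d::finite \<Rightarrow> circle^'k"
  assumes p: "prime p" and T: "ca_trace p B \<phi> \<noteq> 0"
    and ret: "\<And>b. (\<lambda>j. tnorm (tau \<alpha> (lat_scale (int p ^ m j) b))) \<longlonglongrightarrow> 0"
  shows "rigid_M p \<alpha> B \<phi> (\<lambda>j. (p - 1) * p ^ m j)"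
  unfolding rigid_M_def
proof
  have p0: "p > 0" using p by (rule prime_gt_0_nat)
  fix Q :: "nat \<Rightarrow> (circle^'k) set" assume Q: "Q \<in> partitions p"
  then have disj: "disjoint_family_on Q {..<p}" by (simp add: partitions_def)
  obtain X where X: "\<And>j. X j \<in> sets leb" "(\<lambda>j. measure leb (X j)) \<longlonglongrightarrow> 0"
    and G: "\<And>j s. s \<notin> X j \<Longrightarrow> s \<in> good_points p \<alpha> Q"
    and const: "\<And>j s b. s \<notin> X j \<Longrightarrow> b \<in> Poly_Mapping.keys (ca_poly B \<phi> ^ (p - 1)) \<Longrightarrow>
         config_of p \<alpha> Q s (lat_scale (int p ^ m j) b) = config_of p \<alpha> Q s 0"
    by (rule orbit_changes_null[OF Q finite_keys[of "ca_poly B \<phi> ^ (p - 1)"] ret]) (rule that)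
  show "(\<lambda>k. d_tri p ((ca_part p \<alpha> B \<phi> ^^ ((p - 1) * p ^ m k)) Q) Q) \<longlonglongrightarrow> 0"
  proof (rule d_tri_tendsto_0[OF X])
    fix j a assume a: "a < p"
    have "s \<in> (ca_part p \<alpha> B \<phi> ^^ ((p - 1) * p ^ m j)) Q a \<longleftrightarrow> s \<in> Q a" if s: "s \<notin> X j" for s
    proof -
      have "(ca_map p B \<phi> ^^ ((p - 1) * p ^ m j)) (config_of p \<alpha> Q s) 0 = config_of p \<alpha> Q s 0"
        using const[OF s] config_of_less[OF disj G[OF s]] by (intro ca_map_rigid[OF p T]) simp_all
      then show ?thesis
        using ca_part_iterate_iff[OF p0 disj G[OF s] a, where l = 0 and B = B and \<phi> = \<phi> and n = "(p - 1) * p ^ m j"]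
          ca_part_iterate_iff[OF p0 disj G[OF s] a, where l = 0 and B = B and \<phi> = \<phi> and n = 0] by simp
    qed
    then show "sym_diff ((ca_part p \<alpha> B \<phi> ^^ ((p - 1) * p ^ m j)) Q a) (Q a) \<subseteq> X j" by blast
  qed
qed

section \<open>Density of visits\<close>

text \<open>
  The boxes that define the Besicovitch pseudometric.
\<close>

definition lat_box :: "nat \<Rightarrow> (int^'d) set" where
  "lat_box N = {l. \<forall>d. l $ d \<in> {- int N..<int N}}"

lemma card_lat_box: "card (lat_box N :: (int^'d::finite) set) = (2 * N) ^ CARD('d)"
  unfolding lat_box_def by (subst card_vec_box) (simp add: nat_mult_distrib power_mult_distrib)

lemma finite_lat_box [simp]: "finite (lat_box N :: (int^'d::finite) set)"
  unfolding lat_box_def by (intro finite_vec_box) simp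

definition box_density :: "(int^'d::finite) set \<Rightarrow> nat \<Rightarrow> real" where
  "box_density A N = real (card (A \<inter> lat_box N)) / (2 * real N) ^ CARD('d)"

lemma d_B_eq: "d_B x y = limsup (\<lambda>N. ereal (box_density {l. x l \<noteq> y l} N))"
proof -
  have "{l. x l \<noteq> y l} \<inter> lat_box N = {l. (\<forall>d. l $ d \<in> {- int N..<int N}) \<and> x l \<noteq> y l}" for N
    by (auto simp: lat_box_def)
  then show ?thesis by (simp add: d_B_def box_density_def)
qed

lemma box_density_mono: "A \<subseteq> A' \<Longrightarrow> box_density A N \<le> box_density A' N"
  unfolding box_density_def by (intro divide_right_mono of_nat_mono card_mono) auto

lemma d_B_mono:
  assumes "{l. x l \<noteq> y l} \<subseteq> A"
  shows "d_B x y \<le> limsup (\<lambda>N. ereal (box_density A N))"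
  unfolding d_B_eq by (intro Limsup_mono always_eventually allI) (simp add: box_density_mono[OF assms])

lemma d_B_nonneg: "0 \<le> d_B x y"
  unfolding d_B_eq by (intro le_Limsup always_eventually) (auto simp: box_density_def)

lemma card_filter_eq_sum:
  "finite S \<Longrightarrow> card {x\<in>S. Q x} = (\<Sum>x\<in>S. if Q x then 1 else 0)"
  by (simp only: card_eq_sum sum.inter_filter)

text \<open>
  Count the pairs \<open>(l, v)\<close> with \<open>l + h v \<in> A\<close> and \<open>l\<close> in a box. For each \<open>l\<close> there are at most
  \<open>c |V|\<close> of them. For each \<open>v\<close> there is at least one for each point of \<open>A\<close> in the box that is smaller
  by the maximal length \<open>H\<close> of the vectors \<open>h v\<close>. The ratio of the volumes of the two boxes tends to \<open>1\<close>.
\<close>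

lemma limsup_box_density_le:
  fixes A :: "(int^'d::finite) set" and h :: "'v \<Rightarrow> int^'d"
  assumes V: "finite V" "V \<noteq> {}"
    and hits: "\<And>l. real (card {v\<in>V. l + h v \<in> A}) \<le> c * real (card V)"
  shows "limsup (\<lambda>N. ereal (box_density A N)) \<le> ereal c"
proof -
  define H where "H = nat (Max ((\<lambda>(v, d). \<bar>h v $ d\<bar>) ` (V \<times> UNIV)))"
  have H: "\<bar>h v $ d\<bar> \<le> int H" if "v \<in> V" for v d
  proof -
    have "\<bar>h v $ d\<bar> \<le> Max ((\<lambda>(v, d). \<bar>h v $ d\<bar>) ` (V \<times> UNIV))"
      using V that by (intro Max_ge) (auto intro!: image_eqI[of _ _ "(v, d)"])
    then show ?thesis unfolding H_def by linarith
  qed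
  have count: "real (card (A \<inter> lat_box N)) \<le> c * (2 * real (N + H)) ^ CARD('d)" for N
  proof -
    let ?B = "lat_box (N + H) :: (int^'d) set"
    have "card (A \<inter> lat_box N) \<le> card {l\<in>?B. l + h v \<in> A}" if "v \<in> V" for v
    proof (rule card_inj_on_le)
      show "inj_on (\<lambda>l. l - h v) (A \<inter> lat_box N)" by (simp add: inj_on_def)
      show "(\<lambda>l. l - h v) ` (A \<inter> lat_box N) \<subseteq> {l\<in>?B. l + h v \<in> A}"
      proof (intro image_subsetI CollectI conjI)
        fix l assume l: "l \<in> A \<inter> lat_box N"
        then show "l - h v + h v \<in> A" by simp
        show "l - h v \<in> ?B"
          unfolding lat_box_def
        proof (intro CollectI allI)
          fix d
          have "l $ d \<in> {- int N..<int N}" using l by (auto simp: lat_box_def)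
          then show "(l - h v) $ d \<in> {- int (N + H)..<int (N + H)}"
            using H[OF that, of d] by auto
        qed
      qed
    qed simp
    then have "(\<Sum>v\<in>V. card (A \<inter> lat_box N)) \<le> (\<Sum>v\<in>V. card {l\<in>?B. l + h v \<in> A})"
      by (rule sum_mono)
    also have "\<dots> = (\<Sum>v\<in>V. \<Sum>l\<in>?B. if l + h v \<in> A then 1 else 0)"
      by (simp only: card_filter_eq_sum[OF finite_lat_box])
    also have "\<dots> = (\<Sum>l\<in>?B. \<Sum>v\<in>V. if l + h v \<in> A then 1 else 0)" by (rule sum.swap)
    also have "\<dots> = (\<Sum>l\<in>?B. card {v\<in>V. l + h v \<in> A})"
      by (simp only: card_filter_eq_sum[OF V(1)])
    finally have "card V * card (A \<inter> lat_box N) \<le> (\<Sum>l\<in>?B. card {v\<in>V. l + h v \<in> A})" by simp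
    then have "real (card V * card (A \<inter> lat_box N)) \<le> real (\<Sum>l\<in>?B. card {v\<in>V. l + h v \<in> A})"
      by (rule of_nat_mono)
    then have "real (card V) * real (card (A \<inter> lat_box N)) \<le> (\<Sum>l\<in>?B. real (card {v\<in>V. l + h v \<in> A}))"
      by (simp only: of_nat_mult of_nat_sum)
    also have "\<dots> \<le> (\<Sum>l\<in>?B. c * real (card V))" using hits by (intro sum_mono)
    also have "\<dots> = real (card V) * (c * (2 * real (N + H)) ^ CARD('d))" by (simp add: card_lat_box)
    finally show ?thesis using V by (simp add: card_gt_0_iff)
  qed
  have "(\<lambda>N. 1 + real H * (1 / real N)) \<longlonglongrightarrow> 1 + real H * 0"
    by (intro tendsto_intros lim_1_over_n)
  then have "(\<lambda>N. c * (1 + real H * (1 / real N)) ^ CARD('d)) \<longlonglongrightarrow> c * (1 + real H * 0) ^ CARD('d)"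
    by (intro tendsto_intros)
  then have lim: "(\<lambda>N. ereal (c * (1 + real H * (1 / real N)) ^ CARD('d))) \<longlonglongrightarrow> ereal c"
    by (simp add: tendsto_ereal)
  have "limsup (\<lambda>N. ereal (box_density A N)) \<le> limsup (\<lambda>N. ereal (c * (1 + real H * (1 / real N)) ^ CARD('d)))"
  proof (rule Limsup_mono, rule eventually_mono[OF eventually_gt_at_top[of 0]])
    fix N :: nat assume N: "N > 0"
    have "box_density A N \<le> c * (2 * real (N + H)) ^ CARD('d) / (2 * real N) ^ CARD('d)"
      unfolding box_density_def by (intro divide_right_mono count) simp
    also have "\<dots> = c * (2 * real (N + H) / (2 * real N)) ^ CARD('d)" by (simp add: power_divide)
    also have "2 * real (N + H) / (2 * real N) = 1 + real H * (1 / real N)"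
      using N by (simp add: field_simps)
    finally show "ereal (box_density A N) \<le> ereal (c * (1 + real H * (1 / real N)) ^ CARD('d))" by simp
  qed
  also have "\<dots> = ereal c" by (rule lim_imp_Limsup[OF _ lim]) simp
  finally show ?thesis .
qed

text \<open>
  To a grid point whose neighbourhood lies in \<open>U'\<close>, attach the grid cell of which it is the corner.
  These cells are disjoint, lie in \<open>U'\<close>, and each has measure \<open>1 / |V|\<close>. They are cut out of the unit
  cube at a representative \<open>x\<close> of \<open>s\<close>, so that no cell is wrapped around the torus.
\<close>

lemma grid_points_near_le:
  fixes U' :: "(circle^'k) set" and n :: nat
  assumes U: "U' \<in> sets borel" and n: "n > 0"
    and V: "V = {v :: int^'k. \<forall>i. v $ i \<in> {0..<int n}}"
  shows "real (card {v\<in>V. \<forall>z. tnorm (z - (s + to_torus ((1 / real n) *\<^sub>R int_vec v))) < 1 / real n \<longrightarrow> z \<in> U'})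
    \<le> measure haar U' * real (card V)"
proof -
  obtain x where x: "to_torus x = s" by (rule to_torus_surj)
  let ?W = "{v\<in>V. \<forall>z. tnorm (z - (s + to_torus ((1 / real n) *\<^sub>R int_vec v))) < 1 / real n \<longrightarrow> z \<in> U'}"
  have fV: "finite V" unfolding V by (intro finite_vec_box) simp
  have cV: "real (card V) = real n ^ CARD('k)" unfolding V by (subst card_vec_box) simp
  define cell where "cell v = {z. (- real n *\<^sub>R x - int_vec v) + real n *\<^sub>R z \<in> unit_cube_at 0}" for v
  have cell_iff: "z \<in> cell v \<longleftrightarrow> real n *\<^sub>R (z - x) - int_vec v \<in> unit_cube_at 0" for z v
    unfolding cell_def by (simp add: algebra_simps)
  have cell_fm: "cell v \<in> fmeasurable lborel" and cell_measure: "measure lborel (cell v) = 1 / real n ^ CARD('k)" for v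
  proof -
    have u: "emeasure lborel (unit_cube_at (0 :: real^'k)) = 1"
    proof -
      have "emeasure (haar :: (circle^'k) measure) (space haar) = 1" by (rule haar.emeasure_space_1)
      then show ?thesis using emeasure_haar[of "UNIV :: (circle^'k) set" 0] by simp
    qed
    show "cell v \<in> fmeasurable lborel" unfolding cell_def
      using n u by (intro lborel_scale_vimage(2)) auto
    show "measure lborel (cell v) = 1 / real n ^ CARD('k)" unfolding cell_def
      using n u by (subst lborel_scale_vimage(1)) (auto simp: measure_def)
  qed
  have "disjoint_family_on cell ?W"
    unfolding disjoint_family_on_def
  proof (intro ballI impI, rule ccontr)
    fix v w assume vw: "v \<noteq> w" "cell v \<inter> cell w \<noteq> {}"
    then obtain z where "z \<in> cell v" "z \<in> cell w" by blast
    then have "real n *\<^sub>R (z - x) \<in> unit_cube_at (0 + int_vec v)" "real n *\<^sub>R (z - x) \<in> unit_cube_at (0 + int_vec w)"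
      using unit_cube_at_add[of _ _ "0 :: real^'k"] unfolding cell_iff by (metis diff_add_cancel)+
    then show False using unit_cubes_tile[of "real n *\<^sub>R (z - x)" 0] vw(1) by blast
  qed
  then have "(\<Sum>v\<in>?W. measure lborel (cell v)) = measure lborel (\<Union>v\<in>?W. cell v)"
  proof (intro measure_finite_Union[symmetric])
    show "finite ?W" using fV by simp
    show "cell ` ?W \<subseteq> sets lborel" using fmeasurableD[OF cell_fm] by blast
    show "emeasure lborel (cell v) \<noteq> \<infinity>" for v using fmeasurableD2[OF cell_fm] by simp
  qed
  also have "\<dots> \<le> measure lborel (to_torus -` U' \<inter> unit_cube_at x)"
  proof (rule measure_mono_fmeasurable)
    show "(\<Union>v\<in>?W. cell v) \<subseteq> to_torus -` U' \<inter> unit_cube_at x"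
    proof
      fix z assume "z \<in> (\<Union>v\<in>?W. cell v)"
      then obtain v where v: "v \<in> ?W" "z \<in> cell v" by blast
      have "\<bar>((z - x) - (1 / real n) *\<^sub>R int_vec v) $ i\<bar> < 1 / real n" for i
        using v(2) unfolding cell_iff by (rule unit_cube_digits_close[OF _ n])
      then have "tnorm (to_torus ((z - x) - (1 / real n) *\<^sub>R int_vec v)) < 1 / real n"
        by (rule tnorm_to_torus_less)
      then have "tnorm (to_torus z - (s + to_torus ((1 / real n) *\<^sub>R int_vec v))) < 1 / real n"
        unfolding to_torus_diff x by (simp only: diff_diff_eq)
      then have "to_torus z \<in> U'" using v(1) by blast
      moreover have "z \<in> unit_cube_at x"
        unfolding unit_cube_at_def
      proof (intro CollectI allI)
        fix i
        have "v $ i \<in> {0..<int n}" using v(1) unfolding V by blast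
        then have "0 \<le> v $ i" "v $ i + 1 \<le> int n" by auto
        then have w': "0 \<le> real_of_int (v $ i)" "real_of_int (v $ i) + 1 \<le> real n" by linarith+
        have c: "0 \<le> real n * (z $ i - x $ i) - v $ i" "real n * (z $ i - x $ i) - v $ i < 1"
          using v(2) unfolding cell_iff by (auto simp: unit_cube_at_def)
        have "0 \<le> real n * (z $ i - x $ i)" "real n * (z $ i - x $ i) < real n * 1" using c w' by linarith+
        then show "x $ i \<le> z $ i \<and> z $ i < x $ i + 1"
          using n by (auto simp: zero_le_mult_iff mult_less_cancel_left_pos)
      qed
      ultimately show "z \<in> to_torus -` U' \<inter> unit_cube_at x" by blast
    qed
    show "(\<Union>v\<in>?W. cell v) \<in> sets lborel" 
      by (rule sets.finite_UN[OF _ fmeasurableD[OF cell_fm]]) (simp add: fV)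
    have "emeasure lborel (to_torus -` U' \<inter> unit_cube_at x) < \<infinity>"
      using emeasure_haar[OF U, of x] haar.emeasure_finite[of U'] by (simp add: top.not_eq_extremum)
    moreover have "to_torus -` U' \<in> sets borel"
      using measurable_sets[OF to_torus_measurable U] by simp
    ultimately show "to_torus -` U' \<inter> unit_cube_at x \<in> fmeasurable lborel"
      by (intro fmeasurableI) auto
  qed
  also have "\<dots> = measure haar U'" by (simp add: measure_def emeasure_haar[OF U, of x])
  finally have "real (card ?W) / real n ^ CARD('k) \<le> measure haar U'" by (simp add: cell_measure)
  then show ?thesis using n by (simp add: cV field_simps)
qed

text \<open>
  This is the upper bound in the equidistribution of the orbits. By density of the image of \<open>\<tau>\<close>,
  choose lattice vectors \<open>h v\<close> with \<open>\<tau> (h v)\<close> close to the grid points \<open>v / n\<close>. From any point, the proportion of the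
  translates by these vectors that hit \<open>A\<close> is at most the proportion of grid points near which
  \<open>U'\<close> is filled, hence at most the measure of \<open>U'\<close>; then average.
\<close>

lemma limsup_visits_le:
  fixes \<alpha> :: "'d::finite \<Rightarrow> circle^'k"
  assumes dense: "\<forall>s. \<forall>e>0. \<exists>l. tnorm (tau \<alpha> l - s) < e"
    and U: "U' \<in> sets borel" and e: "e > 0"
    and near: "\<And>s z. s \<in> A \<Longrightarrow> tnorm (z - s) < e \<Longrightarrow> z \<in> U'"
  shows "limsup (\<lambda>N. ereal (box_density {l. t + tau \<alpha> l \<in> A} N)) \<le> ereal (measure haar U')"
proof -
  obtain n0 where n0: "1 / real (Suc n0) < e / 2" using e nat_approx_posE[of "e / 2"] by auto
  define n where "n = Suc n0"
  have n: "n > 0" "1 / real n < e / 2" using n0 by (auto simp: n_def)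
  define V where "V = {v :: int^'k. \<forall>i. v $ i \<in> {0..<int n}}"
  have "\<forall>v. \<exists>l. tnorm (tau \<alpha> l - to_torus ((1 / real n) *\<^sub>R int_vec v)) < 1 / real n"
    using dense n by simp
  then obtain h where h: "\<And>v. tnorm (tau \<alpha> (h v) - to_torus ((1 / real n) *\<^sub>R int_vec v)) < 1 / real n"
    by metis
  show ?thesis
  proof (rule limsup_box_density_le)
    show fV: "finite V" unfolding V_def by (intro finite_vec_box) simp
    have "0 \<in> V" using n by (simp add: V_def)
    then show "V \<noteq> {}" by blast
    fix l
    let ?s = "t + tau \<alpha> l"
    have "z \<in> U'" if "l + h v \<in> {l. t + tau \<alpha> l \<in> A}"
        "tnorm (z - (?s + to_torus ((1 / real n) *\<^sub>R int_vec v))) < 1 / real n" for v z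
    proof (rule near)
      show "?s + tau \<alpha> (h v) \<in> A" using that(1) by (simp add: tau_add add.assoc)
      have "tnorm ((?s + to_torus ((1 / real n) *\<^sub>R int_vec v)) - (?s + tau \<alpha> (h v))) < 1 / real n"
        using h[of v] by (subst tnorm_minus_commute) simp
      then have "tnorm (z - (?s + tau \<alpha> (h v))) < 1 / real n + 1 / real n"
        by (rule tnorm_triangle_less[OF that(2)])
      then show "tnorm (z - (?s + tau \<alpha> (h v))) < e" using n by linarith
    qed
    then have "card {v\<in>V. l + h v \<in> {l. t + tau \<alpha> l \<in> A}}
      \<le> card {v\<in>V. \<forall>z. tnorm (z - (?s + to_torus ((1 / real n) *\<^sub>R int_vec v))) < 1 / real n \<longrightarrow> z \<in> U'}"
      using fV by (intro card_mono) auto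
    then have "real (card {v\<in>V. l + h v \<in> {l. t + tau \<alpha> l \<in> A}})
      \<le> real (card {v\<in>V. \<forall>z. tnorm (z - (?s + to_torus ((1 / real n) *\<^sub>R int_vec v))) < 1 / real n \<longrightarrow> z \<in> U'})"
      by simp
    also have "\<dots> \<le> measure haar U' * real (card V)" by (rule grid_points_near_le[OF U n(1) V_def])
    finally show "real (card {v\<in>V. l + h v \<in> {l. t + tau \<alpha> l \<in> A}}) \<le> measure haar U' * real (card V)" .
  qed
qed

section \<open>Niltropy and rigidity for quasisturmian configurations\<close>

text \<open>
  The points that a translation of length less than \<open>e\<close> may carry out of their own cell, together
  with those that lie in no cell.
\<close>

definition boundary_layer :: "nat \<Rightarrow> (nat \<Rightarrow> (circle^'k) set) \<Rightarrow> real \<Rightarrow> (circle^'k) set" where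
  "boundary_layer p P e = - (\<Union>a<p. erode e (P a))"

lemma boundary_layer_borel: "boundary_layer p P e \<in> sets borel"
  unfolding boundary_layer_def by (intro borel_comp sets.finite_UN) auto

lemma boundary_layer_near:
  assumes "s \<in> boundary_layer p P e" "tnorm (z - s) < d"
  shows "z \<in> boundary_layer p P (d + e)"
  using assms erode_ball[OF assms(2)] unfolding boundary_layer_def by blast

text \<open>
  As \<open>e\<close> tends to \<open>0\<close>, the layers shrink to the complement of the union of the cells, because the
  cells are open; and this complement is null.
\<close>

lemma measure_boundary_layer:
  assumes P: "open_partition p P"
  shows "(\<lambda>n. measure haar (boundary_layer p P (1 / real (Suc n)))) \<longlonglongrightarrow> 0"
proof -
  have op: "open (P a)" if "a < p" for a using P that by (simp add: open_partition_def)
  have "decseq (\<lambda>n. boundary_layer p P (1 / real (Suc n)))"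
    unfolding decseq_def boundary_layer_def
    by (intro allI impI iffD2[OF Compl_subset_Compl_iff] UN_mono order_refl erode_antimono) (simp add: frac_le)
  then have "(\<lambda>n. measure haar (boundary_layer p P (1 / real (Suc n))))
      \<longlonglongrightarrow> measure haar (\<Inter>n. boundary_layer p P (1 / real (Suc n)))"
    by (intro haar.finite_Lim_measure_decseq) (auto simp: boundary_layer_borel)
  also have "(\<Inter>n. boundary_layer p P (1 / real (Suc n))) = - part_union p P"
  proof -
    have "(\<Inter>n. boundary_layer p P (1 / real (Suc n))) = - (\<Union>a<p. \<Union>n. erode (1 / real (Suc n)) (P a))"
      unfolding boundary_layer_def by blast
    also have "\<dots> = - (\<Union>a<p. P a)" using open_erode_exhausts[OF op] by simp
    finally show ?thesis by (simp add: part_union_def)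
  qed
  also have "measure haar (- part_union p P) = 0"
  proof -
    have U: "part_union p P \<in> sets borel"
      unfolding part_union_def using op by (intro borel_open open_UN) auto
    have "measure haar (part_union p P) = 1"
      using P measure_leb_borel[OF U] by (simp add: open_partition_def partitions_def)
    then show ?thesis using haar.prob_compl[of "part_union p P"] U by (simp add: Compl_eq_Diff_UNIV)
  qed
  finally show ?thesis .
qed

text \<open>
  Once the translations by \<open>\<tau> (v j b)\<close> are shorter than \<open>d\<close>, the label changes only at times when the
  orbit is in the boundary layer of width \<open>d\<close>. The layer of width \<open>2 d\<close> contains a neighbourhood
  of it and has measure less than \<open>e\<close>.
\<close>

lemma orbit_changes_rare:
  fixes \<alpha> :: "'d::finite \<Rightarrow> circle^'k"
  assumes dense: "\<forall>s. \<forall>e>0. \<exists>l. tnorm (tau \<alpha> l - s) < e"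
    and P: "open_partition p P" and t: "t \<in> good_points p \<alpha> P"
    and fin: "finite K" and ret: "\<And>b. (\<lambda>j. tnorm (tau \<alpha> (v j b))) \<longlonglongrightarrow> 0"
    and e: "e > 0"
  shows "\<forall>\<^sub>F j in sequentially. limsup (\<lambda>N. ereal (box_density
    {l. \<exists>b\<in>K. config_of p \<alpha> P t (l + v j b) \<noteq> config_of p \<alpha> P t l} N)) \<le> ereal e"
proof -
  have disj: "disjoint_family_on P {..<p}" using P by (simp add: open_partition_def partitions_def)
  obtain n where n: "measure haar (boundary_layer p P (1 / real (Suc n))) < e"
    using order_tendstoD(2)[OF measure_boundary_layer[OF P] e] by (auto simp: eventually_sequentially)
  define d where "d = 1 / real (Suc n) / 2"
  have d: "d > 0" "d + d = 1 / real (Suc n)" by (simp_all add: d_def field_simps)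
  have "\<forall>\<^sub>F j in sequentially. \<forall>b\<in>K. tnorm (tau \<alpha> (v j b)) < d"
    using fin d ret by (intro eventually_ball_finite ballI order_tendstoD(2)) auto
  then show ?thesis
  proof eventually_elim
    fix j assume j: "\<forall>b\<in>K. tnorm (tau \<alpha> (v j b)) < d"
    have "{l. \<exists>b\<in>K. config_of p \<alpha> P t (l + v j b) \<noteq> config_of p \<alpha> P t l}
        \<subseteq> {l. t + tau \<alpha> l \<in> boundary_layer p P d}"
    proof (intro subsetI CollectI, rule ccontr)
      fix l assume "l \<in> {l. \<exists>b\<in>K. config_of p \<alpha> P t (l + v j b) \<noteq> config_of p \<alpha> P t l}"
      then obtain b where b: "b \<in> K" "config_of p \<alpha> P t (l + v j b) \<noteq> config_of p \<alpha> P t l" by blast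
      assume "t + tau \<alpha> l \<notin> boundary_layer p P d"
      then obtain a where a: "a < p" "t + tau \<alpha> l \<in> erode d (P a)" by (auto simp: boundary_layer_def)
      then have "t + tau \<alpha> l \<in> P a" using erode_subset[OF d(1)] by blast
      moreover have "t + tau \<alpha> (l + v j b) \<in> P a"
        using a(2) j b(1) by (auto simp: erode_def tau_add)
      ultimately show False using config_of_eq[OF disj t a(1)] b(2) by metis
    qed
    then have "limsup (\<lambda>N. ereal (box_density {l. \<exists>b\<in>K. config_of p \<alpha> P t (l + v j b) \<noteq> config_of p \<alpha> P t l} N))
        \<le> limsup (\<lambda>N. ereal (box_density {l. t + tau \<alpha> l \<in> boundary_layer p P d} N))"
      by (intro Limsup_mono always_eventually allI) (simp add: box_density_mono)
    also have "\<dots> \<le> ereal (measure haar (boundary_layer p P (d + d)))"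
      by (rule limsup_visits_le[OF dense boundary_layer_borel d(1)]) (rule boundary_layer_near)
    also have "\<dots> \<le> ereal e" using n d by simp
    finally show "limsup (\<lambda>N. ereal (box_density {l. \<exists>b\<in>K. config_of p \<alpha> P t (l + v j b) \<noteq> config_of p \<alpha> P t l} N)) \<le> ereal e" .
  qed
qed

lemma d_B_tendsto_0:
  assumes "\<And>e. e > 0 \<Longrightarrow> \<forall>\<^sub>F j in sequentially. d_B (x j) y \<le> ereal e"
  shows "(\<lambda>j. d_B (x j) y) \<longlonglongrightarrow> 0"
proof (rule order_tendstoI)
  fix a :: ereal assume "a < 0"
  then show "\<forall>\<^sub>F j in sequentially. a < d_B (x j) y"
    using d_B_nonneg by (intro always_eventually allI) (rule order_less_le_trans)
next
  fix a :: ereal assume "0 < a"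
  then obtain e where e: "0 < ereal e" "ereal e < a" using ereal_dense2 by blast
  then have "\<forall>\<^sub>F j in sequentially. d_B (x j) y \<le> ereal e" using assms[of e] by simp
  then show "\<forall>\<^sub>F j in sequentially. d_B (x j) y < a"
    by eventually_elim (use e in order)
qed

lemma niltropic_QS_return_times:
  fixes \<alpha> :: "'d::finite \<Rightarrow> circle^'k"
  assumes dense: "\<forall>s. \<forall>e>0. \<exists>l. tnorm (tau \<alpha> l - s) < e"
    and p: "prime p" and T: "ca_trace p B \<phi> = 0"
    and ret: "\<And>b. (\<lambda>j. tnorm (tau \<alpha> (lat_scale (int p ^ m j) b))) \<longlonglongrightarrow> 0"
  shows "niltropic_QS p \<alpha> B \<phi> (\<lambda>j. p ^ m j)"
  unfolding niltropic_QS_def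
proof
  fix q assume "q \<in> QS p \<alpha>"
  then obtain P t where P: "open_partition p P" and t: "t \<in> good_points p \<alpha> P"
    and q: "q = config_of p \<alpha> P t" by (auto simp: QS_def)
  let ?K = "Poly_Mapping.keys (ca_poly B \<phi>)"
  show "(\<lambda>k. d_B ((ca_map p B \<phi> ^^ p ^ m k) q) (\<lambda>_. 0)) \<longlonglongrightarrow> 0"
  proof (rule d_B_tendsto_0)
    fix e :: real assume "e > 0"
    have "{l. (ca_map p B \<phi> ^^ p ^ m j) q l \<noteq> 0} \<subseteq> {l. \<exists>b\<in>?K. q (l + lat_scale (int p ^ m j) b) \<noteq> q l}" for j
    proof (rule subsetI, rule CollectI, rule ccontr)
      fix l assume l: "l \<in> {l. (ca_map p B \<phi> ^^ p ^ m j) q l \<noteq> 0}"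
        and "\<not> (\<exists>b\<in>?K. q (l + lat_scale (int p ^ m j) b) \<noteq> q l)"
      then have "(ca_map p B \<phi> ^^ p ^ m j) q l = 0" by (intro ca_map_niltropic[OF p T]) simp
      then show False using l by simp
    qed
    moreover have "\<forall>\<^sub>F j in sequentially. limsup (\<lambda>N. ereal (box_density
        {l. \<exists>b\<in>?K. q (l + lat_scale (int p ^ m j) b) \<noteq> q l} N)) \<le> ereal e"
      unfolding q by (rule orbit_changes_rare[OF dense P t finite_keys ret \<open>e > 0\<close>])
    ultimately show "\<forall>\<^sub>F j in sequentially. d_B ((ca_map p B \<phi> ^^ p ^ m j) q) (\<lambda>_. 0) \<le> ereal e"
      by (elim eventually_mono) (rule order_trans[OF d_B_mono])
  qed
qed

lemma rigid_QS_return_times: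
  fixes \<alpha> :: "'d::finite \<Rightarrow> circle^'k"
  assumes dense: "\<forall>s. \<forall>e>0. \<exists>l. tnorm (tau \<alpha> l - s) < e"
    and p: "prime p" and T: "ca_trace p B \<phi> \<noteq> 0"
    and ret: "\<And>b. (\<lambda>j. tnorm (tau \<alpha> (lat_scale (int p ^ m j) b))) \<longlonglongrightarrow> 0"
  shows "rigid_QS p \<alpha> B \<phi> (\<lambda>j. (p - 1) * p ^ m j)"
  unfolding rigid_QS_def
proof
  fix q assume "q \<in> QS p \<alpha>"
  then obtain P t where P: "open_partition p P" and t: "t \<in> good_points p \<alpha> P"
    and q: "q = config_of p \<alpha> P t" by (auto simp: QS_def)
  have disj: "disjoint_family_on P {..<p}" using P by (simp add: open_partition_def partitions_def)
  have q_less: "q l < p" for l unfolding q by (rule config_of_less[OF disj t])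
  let ?K = "Poly_Mapping.keys (ca_poly B \<phi> ^ (p - 1))"
  show "(\<lambda>k. d_B ((ca_map p B \<phi> ^^ ((p - 1) * p ^ m k)) q) q) \<longlonglongrightarrow> 0"
  proof (rule d_B_tendsto_0)
    fix e :: real assume "e > 0"
    have "{l. (ca_map p B \<phi> ^^ ((p - 1) * p ^ m j)) q l \<noteq> q l} \<subseteq> {l. \<exists>b\<in>?K. q (l + lat_scale (int p ^ m j) b) \<noteq> q l}" for j
    proof (rule subsetI, rule CollectI, rule ccontr)
      fix l assume l: "l \<in> {l. (ca_map p B \<phi> ^^ ((p - 1) * p ^ m j)) q l \<noteq> q l}"
        and "\<not> (\<exists>b\<in>?K. q (l + lat_scale (int p ^ m j) b) \<noteq> q l)"
      then have "(ca_map p B \<phi> ^^ ((p - 1) * p ^ m j)) q l = q l"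
        by (intro ca_map_rigid[OF p T] q_less) simp
      then show False using l by simp
    qed
    moreover have "\<forall>\<^sub>F j in sequentially. limsup (\<lambda>N. ereal (box_density
        {l. \<exists>b\<in>?K. q (l + lat_scale (int p ^ m j) b) \<noteq> q l} N)) \<le> ereal e"
      unfolding q by (rule orbit_changes_rare[OF dense P t finite_keys ret \<open>e > 0\<close>])
    ultimately show "\<forall>\<^sub>F j in sequentially. d_B ((ca_map p B \<phi> ^^ ((p - 1) * p ^ m j)) q) q \<le> ereal e"
      by (elim eventually_mono) (rule order_trans[OF d_B_mono])
  qed
qed

theorem theorem13p2:
  fixes p :: nat
  assumes "prime p"
  shows "AE \<alpha> in (\<Pi>\<^sub>M d\<in>(UNIV :: 'd::finite set). (haar :: (circle^'k::finite) measure)).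
    admissible \<alpha> \<and>
    (\<exists>m :: nat \<Rightarrow> nat. \<forall>B \<phi>. linear_ca p B \<phi> \<longrightarrow>
       (ca_trace p B \<phi> = 0 \<longrightarrow>
          niltropic_M p \<alpha> B \<phi> (\<lambda>j. p ^ m j) \<and> niltropic_QS p \<alpha> B \<phi> (\<lambda>j. p ^ m j)) \<and>
       (ca_trace p B \<phi> \<noteq> 0 \<longrightarrow>
          rigid_M p \<alpha> B \<phi> (\<lambda>j. (p - 1) * p ^ m j) \<and>
          rigid_QS p \<alpha> B \<phi> (\<lambda>j. (p - 1) * p ^ m j)))"
  using AE_dense_orbit[OF prime_ge_2_nat[OF assms]]
proof eventually_elim
  fix \<alpha> :: "'d \<Rightarrow> circle^'k"
  assume \<alpha>: "dense_orbit p \<alpha>"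
  have dense: "\<forall>s. \<forall>e>0. \<exists>l. tnorm (tau \<alpha> l - s) < e"
    using dense_orbit_tau_dense[OF \<alpha>] by metis
  obtain m where m: "\<And>b. (\<lambda>j. tnorm (tau \<alpha> (lat_scale (int p ^ m j) b))) \<longlonglongrightarrow> 0"
    by (rule dense_orbit_return_times[OF \<alpha>]) (rule that)
  show "admissible \<alpha> \<and>
    (\<exists>m :: nat \<Rightarrow> nat. \<forall>B \<phi>. linear_ca p B \<phi> \<longrightarrow>
       (ca_trace p B \<phi> = 0 \<longrightarrow>
          niltropic_M p \<alpha> B \<phi> (\<lambda>j. p ^ m j) \<and> niltropic_QS p \<alpha> B \<phi> (\<lambda>j. p ^ m j)) \<and>
       (ca_trace p B \<phi> \<noteq> 0 \<longrightarrow>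
          rigid_M p \<alpha> B \<phi> (\<lambda>j. (p - 1) * p ^ m j) \<and>
          rigid_QS p \<alpha> B \<phi> (\<lambda>j. (p - 1) * p ^ m j)))"
    using inj_tau[OF \<alpha>] closure_range_tau[OF \<alpha>]
      niltropic_M_return_times[OF assms _ m] niltropic_QS_return_times[OF dense assms _ m]
      rigid_M_return_times[OF assms _ m] rigid_QS_return_times[OF dense assms _ m]
    unfolding admissible_def by blast
qed

end
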